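(* Let $1<\ell<m$ be integers and let $D\subset\{1,\dots,m\}\times\{1,\dots,\ell\}$ be a nonempty pattern having the same number of elements in every row. Then the Bedford-McMullen carpet with uniform fibers $K(D)$ is minimal for conformal dimension, i.e. $\dim_C K(D)=\dim_H K(D)$.
   Context: The Bedford-McMullen carpet $K(D)$: divide $[0,1]^2$ into $m\times\ell$ congruent closed rectangles of width $1/m$ and height $1/\ell$ with disjoint interiors ($m$ columns and $\ell$ rows); keep those corresponding to $D$ and let $K_1$ be their union. Inductively, divide each retained rectangle (width $m^{-n}$, height $\ell^{-n}$) of $K_n$ into $m\times\ell$ congruent closed rectangles of width $m^{-(n+1)}$ and height $\ell^{-(n+1)}$, keep those corresponding to $D$, and let $K_{n+1}$ be the union of all kept rectangles. Set $K(D)=\bigcap_n K_n$, with the Euclidean metric. The row $b\in\{1,\dots,\ell\}$ of $D$ is $\{a:(a,b)\in D\}$. $\dim_H$ denotes Hausdorff dimension. A homeomorphism $f:X\to Y$ between metric spaces is quasisymmetric if there is a homeomorphism $\eta:[0,\infty)\to[0,\infty)$ such that $d_Y(f(x),f(y))/d_Y(f(x),f(z))\le\eta\big(d_X(x,y)/d_X(x,z)\big)$ for all $x,y,z\in X$ with $x\neq z$. The conformal dimension is $\dim_C X=\inf\{\dim_H f(X)\}$ over all quasisymmetric homeomorphisms $f$ of $X$ onto metric spaces. $X$ is minimal for conformal dimension if $\dim_C X=\dim_H X$. *)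

theory Defs
  imports "HOL-Analysis.Analysis"
begin

section \<open>Hausdorff dimension of a metric space\<close>

definition ediam :: "'a metric \<Rightarrow> 'a set \<Rightarrow> ennreal" where
  "ediam X U = (SUP (x, y) \<in> U \<times> U. ennreal (mdist X x y))"

text \<open>The diameter bound makes every \<^term>\<open>ediam X (U i)\<close> finite, so \<^const>\<open>enn2real\<close> loses
  nothing. Finite covers are included: the remaining sets can be taken empty, and
  \<^prop>\<open>(0::real) powr s = 0\<close>.\<close>

definition hausdorff_premeasure :: "'a metric \<Rightarrow> real \<Rightarrow> real \<Rightarrow> ennreal" where
  "hausdorff_premeasure X s \<delta> =
     (INF U \<in> {U :: nat \<Rightarrow> 'a set.
                 (\<forall>i. U i \<subseteq> mspace X \<and> ediam X (U i) \<le> ennreal \<delta>) \<and> mspace X \<subseteq> (\<Union>i. U i)}.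
        \<Sum>i. ennreal (enn2real (ediam X (U i)) powr s))"

definition hausdorff_measure :: "'a metric \<Rightarrow> real \<Rightarrow> ennreal" where
  "hausdorff_measure X s = (SUP \<delta> \<in> {0<..}. hausdorff_premeasure X s \<delta>)"

text \<open>Only exponents \<^prop>\<open>s > (0::real)\<close> are used, which avoids the convention for \<open>0\<^sup>0\<close> and
  does not change the infimum. The dimension is infinite if no exponent qualifies.\<close>

definition hausdorff_dim :: "'a metric \<Rightarrow> ennreal" where
  "hausdorff_dim X = (INF s \<in> {s. 0 < s \<and> hausdorff_measure X s = 0}. ennreal s)"


section \<open>Quasisymmetric homeomorphisms and conformal dimension\<close>

definition quasisymmetric :: "'a metric \<Rightarrow> 'b metric \<Rightarrow> ('a \<Rightarrow> 'b) \<Rightarrow> bool" where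
  "quasisymmetric X Y f \<longleftrightarrow>
     homeomorphic_map (mtopology_of X) (mtopology_of Y) f \<and>
     (\<exists>\<eta> :: real \<Rightarrow> real.
        homeomorphic_map (top_of_set {0..}) (top_of_set {0..}) \<eta> \<and>
        (\<forall>x \<in> mspace X. \<forall>y \<in> mspace X. \<forall>z \<in> mspace X. x \<noteq> z \<longrightarrow>
           mdist Y (f x) (f y) / mdist Y (f x) (f z) \<le> \<eta> (mdist X x y / mdist X x z)))"

text \<open>A definition cannot quantify over types, so the target spaces \<open>Y\<close> have points in the same
  type as \<open>X\<close>. This loses no target: a quasisymmetric image of \<open>X\<close> in any type is isometric to
  the carrier of \<open>X\<close> with the pulled-back metric; see \<open>conformal_dim_le\<close> below.\<close>

definition conformal_dim :: "'a metric \<Rightarrow> ennreal" where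
  "conformal_dim X = Inf {hausdorff_dim Y | (Y :: 'a metric) f. quasisymmetric X Y f}"

definition minimal_for_conformal_dim :: "'a metric \<Rightarrow> bool" where
  "minimal_for_conformal_dim X \<longleftrightarrow> conformal_dim X = hausdorff_dim X"

lemma ediam_isometry:
  assumes "\<And>x y. x \<in> mspace X \<Longrightarrow> y \<in> mspace X \<Longrightarrow> mdist Y (g x) (g y) = mdist X x y"
    and "U \<subseteq> mspace X"
  shows "ediam Y (g ` U) = ediam X U"
proof -
  have *: "(\<lambda>(x, y). ennreal (mdist Y x y)) ` (g ` U \<times> g ` U)
      = (\<lambda>(x, y). ennreal (mdist Y (g x) (g y))) ` (U \<times> U)"
    by force
  also have "\<dots> = (\<lambda>(x, y). ennreal (mdist X x y)) ` (U \<times> U)"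
    using assms(2) by (intro image_cong refl) (auto simp: assms(1) subsetD)
  finally show ?thesis
    by (simp add: ediam_def)
qed

lemma hausdorff_premeasure_isometry_le:
  assumes iso: "\<And>x y. x \<in> mspace X \<Longrightarrow> y \<in> mspace X \<Longrightarrow> mdist Y (g x) (g y) = mdist X x y"
    and im: "g ` mspace X = mspace Y"
  shows "hausdorff_premeasure Y s \<delta> \<le> hausdorff_premeasure X s \<delta>"
  unfolding hausdorff_premeasure_def
proof (rule INF_mono)
  fix U :: "nat \<Rightarrow> 'a set"
  assume U: "U \<in> {U. (\<forall>i. U i \<subseteq> mspace X \<and> ediam X (U i) \<le> ennreal \<delta>) \<and> mspace X \<subseteq> (\<Union>i. U i)}"
  then have ed: "ediam Y (g ` U i) = ediam X (U i)" for i
    by (intro ediam_isometry) (use iso in auto)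
  have "(\<lambda>i. g ` U i) \<in> {V. (\<forall>i. V i \<subseteq> mspace Y \<and> ediam Y (V i) \<le> ennreal \<delta>) \<and>
      mspace Y \<subseteq> (\<Union>i. V i)}"
    using U im ed by (auto; blast)
  then show "\<exists>V \<in> {V :: nat \<Rightarrow> 'b set. (\<forall>i. V i \<subseteq> mspace Y \<and> ediam Y (V i) \<le> ennreal \<delta>) \<and> mspace Y \<subseteq> (\<Union>i. V i)}.
      (\<Sum>i. ennreal (enn2real (ediam Y (V i)) powr s)) \<le> (\<Sum>i. ennreal (enn2real (ediam X (U i)) powr s))"
    by (rule rev_bexI) (simp add: ed)
qed

lemma hausdorff_dim_isometry:
  assumes iso: "\<And>x y. x \<in> mspace X \<Longrightarrow> y \<in> mspace X \<Longrightarrow> mdist Y (g x) (g y) = mdist X x y"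
    and bij: "bij_betw g (mspace X) (mspace Y)"
  shows "hausdorff_dim Y = hausdorff_dim X"
proof -
  let ?h = "inv_into (mspace X) g"
  have im: "g ` mspace X = mspace Y" and imh: "?h ` mspace Y = mspace X"
    using bij bij_betw_inv_into[OF bij] by (auto simp: bij_betw_def)
  have isoh: "mdist X (?h x) (?h y) = mdist Y x y" if "x \<in> mspace Y" "y \<in> mspace Y" for x y
    using iso[of "?h x" "?h y"] that im by (simp add: f_inv_into_f inv_into_into)
  have "hausdorff_premeasure Y s \<delta> = hausdorff_premeasure X s \<delta>" for s \<delta>
    by (intro antisym hausdorff_premeasure_isometry_le[OF iso im]
        hausdorff_premeasure_isometry_le[OF isoh imh])
  then show ?thesis
    by (simp add: hausdorff_dim_def hausdorff_measure_def)
qed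

lemma conformal_dim_le:
  fixes X :: "'a metric" and Y :: "'b metric"
  assumes qs: "quasisymmetric X Y f"
  shows "conformal_dim X \<le> hausdorff_dim Y"
proof -
  have hom: "homeomorphic_map (mtopology_of X) (mtopology_of Y) f"
    using qs by (simp add: quasisymmetric_def)
  have inj: "inj_on f (mspace X)" and im: "f ` mspace X = mspace Y"
    using hom homeomorphic_imp_injective_map homeomorphic_imp_surjective_map by fastforce+
  define Z where "Z = metric (mspace X, \<lambda>x y. mdist Y (f x) (f y))"
  have Z: "Metric_space (mspace X) (\<lambda>x y. mdist Y (f x) (f y))"
  proof
    fix x y z
    assume x: "x \<in> mspace X" and y: "y \<in> mspace X"
    then have Y: "f x \<in> mspace Y" "f y \<in> mspace Y"
      using im by auto
    show "mdist Y (f x) (f y) = 0 \<longleftrightarrow> x = y"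
      using mdist_zero[OF Y] inj_onD[OF inj _ x y] by auto
    assume "z \<in> mspace X"
    then have "f z \<in> mspace Y"
      using im by auto
    then show "mdist Y (f x) (f z) \<le> mdist Y (f x) (f y) + mdist Y (f y) (f z)"
      using Y by (intro mdist_triangle)
  qed (auto intro: mdist_commute)
  have sp: "mspace Z = mspace X" and di: "mdist Z x y = mdist Y (f x) (f y)" for x y
    unfolding Z_def using Metric_space.mspace_metric[OF Z] Metric_space.mdist_metric[OF Z] by auto
  have dimeq: "hausdorff_dim Y = hausdorff_dim Z"
    by (rule hausdorff_dim_isometry[where g = f]) (auto simp: di sp bij_betw_def inj im)
  interpret ZY: Metric_space12 "mspace Z" "mdist Z" "mspace Y" "mdist Y"
    by (simp add: Metric_space12_def)
  have homZ: "homeomorphic_map (mtopology_of Z) (mtopology_of Y) f"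
    unfolding mtopology_of_def
    by (rule ZY.isometry_imp_homeomorphic_map) (auto simp: di sp im)
  obtain k where k: "homeomorphic_maps (mtopology_of Z) (mtopology_of Y) f k"
    using homZ homeomorphic_map_maps by blast
  have "homeomorphic_map (mtopology_of X) (mtopology_of Z) (k \<circ> f)"
    using hom k homeomorphic_map_compose homeomorphic_maps_map by blast
  moreover have "k (f x) = x" if "x \<in> mspace X" for x
    using k that by (simp add: homeomorphic_maps_def sp)
  ultimately have "homeomorphic_map (mtopology_of X) (mtopology_of Z) id"
    by (elim homeomorphic_map_eq) simp
  then have "quasisymmetric X Z id"
    using qs by (simp add: quasisymmetric_def di)
  then show ?thesis
    unfolding dimeq conformal_dim_def by (intro Inf_lower) blast
qed


section \<open>Bedford--McMullen carpets\<close>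

text \<open>The lower left corners of the retained rectangles of generation \<open>n\<close>, which have width
  \<open>1 / m ^ n\<close> and height \<open>1 / l ^ n\<close>. Columns are numbered from the left and rows from the
  bottom, both starting at 1.\<close>

primrec carpet_corners :: "nat \<Rightarrow> nat \<Rightarrow> (nat \<times> nat) set \<Rightarrow> nat \<Rightarrow> (real \<times> real) set" where
  "carpet_corners m l D 0 = {(0, 0)}"
| "carpet_corners m l D (Suc n) =
     {(x + (real a - 1) / real m ^ Suc n, y + (real b - 1) / real l ^ Suc n) | x y a b.
        (x, y) \<in> carpet_corners m l D n \<and> (a, b) \<in> D}"

definition carpet_level :: "nat \<Rightarrow> nat \<Rightarrow> (nat \<times> nat) set \<Rightarrow> nat \<Rightarrow> (real \<times> real) set" where
  "carpet_level m l D n =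
     (\<Union>(x, y) \<in> carpet_corners m l D n. {x..x + 1 / real m ^ n} \<times> {y..y + 1 / real l ^ n})"

definition carpet :: "nat \<Rightarrow> nat \<Rightarrow> (nat \<times> nat) set \<Rightarrow> (real \<times> real) set" where
  "carpet m l D = (\<Inter>n \<in> {1..}. carpet_level m l D n)"

definition pattern_row :: "(nat \<times> nat) set \<Rightarrow> nat \<Rightarrow> nat set" where
  "pattern_row D b = {a. (a, b) \<in> D}"

end

theory Submission
  imports Defs
begin

text \<open>Let \<open>N\<close> be the number of elements in a row and \<open>Q = 1 + log m N\<close>. The carpet is a union of about
  \<open>(N * m)\<^sup>k\<close> approximate squares of side \<open>m\<^sup>-\<^sup>k\<close>, so its Hausdorff dimension is at most \<open>Q\<close>
  (\<open>hausdorff_dim_carpet_le\<close>). It remains to show that every quasisymmetric image has dimension at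
  least \<open>Q\<close> (\<open>hausdorff_dim_quasisymmetric_image_ge\<close>); as the identity is quasisymmetric, both dimensions
  in the statement are then equal to \<open>Q\<close>.

  Since every row has \<open>N\<close> elements, a point is coded by two independent digit sequences, the rows \<open>b\<close>
  and the positions \<open>c\<close> within the rows. An approximate square of side \<open>m\<^sup>-\<^sup>k\<close> fixes \<open>k\<close> positions, but
  about \<open>k log m / log l\<close> rows, which is many more than \<open>k\<close>. Hence for large \<open>k\<close> the squares of side
  \<open>m\<^sup>-\<^sup>k\<^sup>-\<^sup>i\<close> inside it are arranged in \<open>N ^ i\<close> columns, each of about \<open>m ^ i\<close> squares stacked on each
  other and spanning the whole height (\<open>dist_low_Suc\<close>, \<open>dist_low_ends\<close>). The carpet may be totally
  disconnected, but such a column replaces a curve: in the image, the triangle inequality and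
  quasisymmetry bound the sum of the sizes of the squares of a column from below by a constant
  multiple of the size of the large square, with a constant independent of \<open>i\<close> (\<open>column_sum_ge\<close>).

  As \<open>N ^ i * (m ^ i) powr (1 - Q) = 1\<close>, taking powers with exponent \<open>Q\<close> and summing over the columns
  preserves such a bound, again with a constant independent of \<open>i\<close>. For an exponent \<open>s < Q\<close> the small
  squares gain a further factor that is large for large \<open>i\<close>, because their sizes in the image are
  small compared with that of the large square. So for some \<open>i\<close> the \<open>s\<close>-th powers of the sizes satisfy
  \<open>weight of a square \<le> sum of the weights of its children\<close> (\<open>sum_children_ge\<close>). By the tree lemma
  \<open>branch_avoiding\<close>, squares that cover the root square have total weight at least its weight. Within
  the image of the root square, a set of small diameter is covered by boundedly many squares whose
  sizes in the image are at most comparable with its diameter (\<open>cover_by_cells\<close>), so the \<open>s\<close>-dimensional Hausdorff measure of the image is positive.\<close>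


section \<open>Digit expansions\<close>

text \<open>The value of the digit string \<open>d 0, \<dots>, d (n - 1)\<close> in base \<open>B\<close>, the most significant digit first.\<close>

primrec radix :: "nat \<Rightarrow> (nat \<Rightarrow> nat) \<Rightarrow> nat \<Rightarrow> nat" where
  "radix B d 0 = 0"
| "radix B d (Suc n) = B * radix B d n + d n"

text \<open>The real number with base \<open>B\<close> expansion \<open>0.d\<^sub>0d\<^sub>1d\<^sub>2\<dots>\<close>; the digits start at index 0.\<close>

definition expansion :: "nat \<Rightarrow> (nat \<Rightarrow> nat) \<Rightarrow> real" where
  "expansion B d = (\<Sum>t. real (d t) / real B ^ Suc t)"

text \<open>The digit sequence of the \<open>n\<close>-digit string with value \<open>u\<close>, continued by the constant digit \<open>s\<close>.\<close>

definition digits :: "nat \<Rightarrow> nat \<Rightarrow> nat \<Rightarrow> nat \<Rightarrow> nat \<Rightarrow> nat" where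
  "digits B n u s t = (if t < n then (u div B ^ (n - Suc t)) mod B else s)"

lemma radix_cong: "(\<And>t. t < n \<Longrightarrow> d t = d' t) \<Longrightarrow> radix B d n = radix B d' n"
  by (induction n) auto

lemma radix_less:
  assumes "\<And>t. d t < B"
  shows "radix B d n < B ^ n"
proof (induction n)
  case (Suc n)
  have "radix B d (Suc n) < B * Suc (radix B d n)"
    using assms[of n] by simp
  also have "\<dots> \<le> B * B ^ n"
    using Suc by (intro mult_le_mono2) auto
  finally show ?case by simp
qed simp

lemma radix_inj:
  assumes "\<And>t. d t < B" "\<And>t. d' t < B" "radix B d n = radix B d' n" "t < n"
  shows "d t = d' t"
  using assms(3,4)
proof (induction n)
  case (Suc n)
  have "d n = radix B d (Suc n) mod B" "d' n = radix B d' (Suc n) mod B"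
    using assms(1,2) by (simp_all add: mult.commute)
  moreover have "radix B d n = radix B d (Suc n) div B" "radix B d' n = radix B d' (Suc n) div B"
    using assms(1)[of n] assms(2)[of n] by (simp_all add: mult.commute)
  ultimately have "d n = d' n" "radix B d n = radix B d' n"
    using Suc.prems(1) by metis+
  then show ?case
    using Suc by (cases "t = n") auto
qed simp

text \<open>A sequence of integers in which each is the quotient of the next by \<open>B\<close> lists the
  values of the prefixes of one digit string, whose digits are the remainders.\<close>

lemma radix_eq_prefix:
  assumes "h 0 = 0" "\<And>t. t < n \<Longrightarrow> h (Suc t) div B = h t" "\<And>t. t < n \<Longrightarrow> d t = h (Suc t) mod B"
    and "t \<le> n"
  shows "radix B d t = h t"
  using assms(4)
proof (induction t)
  case (Suc t)
  then show ?case
    using assms(2,3)[of t] by (metis Suc_leD Suc_le_eq mult_div_mod_eq radix.simps(2))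
qed (simp add: assms(1))

lemma radix_digits_prefix:
  assumes "u < B ^ n" "t \<le> n"
  shows "radix B (digits B n u s) t = u div B ^ (n - t)"
proof -
  have "u div B ^ (n - Suc t) div B = u div B ^ (n - t)" if "t < n" for t
    using that by (metis Suc_diff_Suc div_mult2_eq power_Suc2)
  then show ?thesis
    using assms by (intro radix_eq_prefix[where h = "\<lambda>t. u div B ^ (n - t)" and n = n])
      (auto simp: digits_def)
qed

lemma radix_digits: "u < B ^ n \<Longrightarrow> radix B (digits B n u s) n = u"
  by (simp add: radix_digits_prefix)

lemma radix_div:
  assumes "\<And>t. d t < B"
  shows "radix B d (n + i) div B ^ i = radix B d n"
proof (induction i)
  case (Suc i)
  have "radix B d (n + Suc i) div B = radix B d (n + i)"
    using assms[of "n + i"] by (simp add: mult.commute)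
  then show ?case
    using Suc by (simp add: div_mult2_eq)
qed simp

lemma digits_less: "s < B \<Longrightarrow> digits B n u s t < B"
  by (auto simp: digits_def)

text \<open>A nested sequence of digit strings, of lengths \<open>K g\<close> and values \<open>U g\<close>, consists of prefixes
  of an infinite digit sequence.\<close>

lemma radix_limit:
  fixes K U :: "nat \<Rightarrow> nat"
  assumes "0 < B" and K: "\<And>g. K g \<le> K (Suc g)" "\<And>g. g \<le> K g"
    and U: "\<And>g. U (Suc g) div B ^ (K (Suc g) - K g) = U g" "U 0 < B ^ K 0"
  shows "\<exists>d. (\<forall>t. d t < B) \<and> (\<forall>g. radix B d (K g) = U g)"
proof -
  have mono: "K g \<le> K g'" if "g \<le> g'" for g g'
    using that K(1) by (rule lift_Suc_mono_le[rotated])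
  have low: "U (g + i) div B ^ (K (g + i) - K g) = U g" for g i
  proof (induction i)
    case (Suc i)
    have "K (g + Suc i) - K g = (K (g + Suc i) - K (g + i)) + (K (g + i) - K g)"
      using mono[of g "g + i"] K(1)[of "g + i"] by simp
    then show ?case
      using Suc U(1)[of "g + i"] by (simp add: power_add div_mult2_eq)
  qed simp
  have Uless: "U g < B ^ K g" for g
  proof -
    have "U g div B ^ (K g - K 0) < B ^ K 0"
      using low[of 0 g] U(2) by simp
    then have "U g < B ^ K 0 * B ^ (K g - K 0)"
      using \<open>0 < B\<close> by (simp add: div_less_iff_less_mult)
    then show ?thesis
      using mono[of 0 g] by (simp flip: power_add)
  qed
  \<comment> \<open>The first \<open>t\<close> digits of \<open>U g\<close> do not depend on \<open>g\<close>, once \<open>t \<le> K g\<close>.\<close>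
  have indep: "U g div B ^ (K g - t) = U g' div B ^ (K g' - t)" if "g \<le> g'" "t \<le> K g" for g g' t
  proof -
    have "K g' - t = (K g' - K g) + (K g - t)"
      using that mono[of g g'] by simp
    then have "U g' div B ^ (K g' - t) = U g' div B ^ (K g' - K g) div B ^ (K g - t)"
      by (metis power_add div_mult2_eq)
    then show ?thesis
      using low[of g "g' - g"] that by simp
  qed
  have indep': "U g div B ^ (K g - t) = U g' div B ^ (K g' - t)" if "t \<le> K g" "t \<le> K g'" for g g' t
  proof (cases "g \<le> g'")
    case True
    then show ?thesis using indep that(1) by blast
  next
    case False
    then show ?thesis using indep[of g' g t] that(2) by (metis nle_le)
  qed
  define d where "d t = (U (Suc t) div B ^ (K (Suc t) - Suc t)) mod B" for t
  have "radix B d (K g) = U g div B ^ (K g - K g)" for g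
  proof (rule radix_eq_prefix[where h = "\<lambda>t. U g div B ^ (K g - t)" and n = "K g"])
    show "U g div B ^ (K g - 0) = 0"
      using Uless by simp
    show "U g div B ^ (K g - Suc t) div B = U g div B ^ (K g - t)" if "t < K g" for t
      using that by (metis Suc_diff_Suc div_mult2_eq power_Suc2)
    show "d t = U g div B ^ (K g - Suc t) mod B" if "t < K g" for t
      unfolding d_def using that K(2)[of "Suc t"]
      by (intro arg_cong[where f = "\<lambda>x. x mod B"] indep') auto
  qed simp
  then show ?thesis
    using \<open>0 < B\<close> by (intro exI[of _ d]) (simp add: d_def)
qed

context
  fixes B :: nat and d :: "nat \<Rightarrow> nat"
  assumes B: "1 < B" and d: "\<And>t. d t < B"
begin

lemma expansion_bound_sums: "(\<lambda>t. real (B - 1) / real B ^ Suc t) sums 1"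
proof -
  have "(\<lambda>t. (1 / real B) ^ t) sums (1 / (1 - 1 / real B))"
    using B by (intro geometric_sums) auto
  then have "(\<lambda>t. (real (B - 1) / real B) * (1 / real B) ^ t) sums
      ((real (B - 1) / real B) * (1 / (1 - 1 / real B)))"
    by (rule sums_mult)
  also have "(real (B - 1) / real B) * (1 / (1 - 1 / real B)) = 1"
    using B by (simp add: field_simps of_nat_diff)
  also have "(\<lambda>t. (real (B - 1) / real B) * (1 / real B) ^ t) =
      (\<lambda>t. real (B - 1) / real B ^ Suc t)"
    by (simp add: power_one_over)
  finally show ?thesis .
qed

lemma expansion_term_le: "real (d t) / real B ^ Suc t \<le> real (B - 1) / real B ^ Suc t"
  using B d[of t] by (intro divide_right_mono) auto

lemma expansion_summable: "summable (\<lambda>t. real (d t) / real B ^ Suc t)"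
proof (rule summable_comparison_test'[OF sums_summable[OF expansion_bound_sums], of 0])
  show "norm (real (d t) / real B ^ Suc t) \<le> real (B - 1) / real B ^ Suc t" for t
    using expansion_term_le[of t] by simp
qed

lemma expansion_nonneg: "0 \<le> expansion B d"
  unfolding expansion_def by (intro suminf_nonneg expansion_summable) auto

lemma expansion_le_1: "expansion B d \<le> 1"
  using suminf_le[OF expansion_term_le expansion_summable sums_summable[OF expansion_bound_sums]]
    sums_unique[OF expansion_bound_sums]
  by (simp add: expansion_def)

lemma expansion_ge_first: "real (d 0) / real B \<le> expansion B d"
  using sum_le_suminf[OF expansion_summable, of "{0}"] by (simp add: expansion_def)

lemma expansion_split:
  "expansion B d = real (radix B d n) / real B ^ n + expansion B (\<lambda>t. d (t + n)) / real B ^ n"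
proof -
  have "expansion B d = (\<Sum>t. real (d (t + n)) / real B ^ Suc (t + n)) +
      (\<Sum>t<n. real (d t) / real B ^ Suc t)"
    unfolding expansion_def by (rule suminf_split_initial_segment[OF expansion_summable])
  moreover have "(\<Sum>t<n. real (d t) / real B ^ Suc t) = real (radix B d n) / real B ^ n"
    using B by (induction n) (auto simp: field_simps)
  moreover have "(\<Sum>t. real (d (t + n)) / real B ^ Suc (t + n)) =
      expansion B (\<lambda>t. d (t + n)) / real B ^ n"
  proof -
    have "summable (\<lambda>t. real (d (t + n)) / real B ^ Suc (t + n))"
      using expansion_summable by (subst summable_iff_shift)
    then have "summable (\<lambda>t. real B ^ n * (real (d (t + n)) / real B ^ Suc (t + n)))"
      by (rule summable_mult)
    then have "summable (\<lambda>t. real (d (t + n)) / real B ^ Suc t)"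
      using B by (simp add: power_add)
    from suminf_divide[OF this, of "real B ^ n"] show ?thesis
      by (simp add: expansion_def power_add mult_ac)
  qed
  ultimately show ?thesis by simp
qed

end

lemma expansion_bounds:
  fixes n :: nat
  assumes "1 < B" "\<And>t. d t < B"
  shows "real (radix B d n) / real B ^ n \<le> expansion B d"
    and "expansion B d \<le> (real (radix B d n) + 1) / real B ^ n"
proof -
  let ?e = "expansion B (\<lambda>t. d (t + n)) / real B ^ n"
  have "0 \<le> expansion B (\<lambda>t. d (t + n))" "expansion B (\<lambda>t. d (t + n)) \<le> 1"
    using assms by (intro expansion_nonneg expansion_le_1; simp)+
  then have "0 \<le> ?e" "?e \<le> 1 / real B ^ n"
    by (intro divide_nonneg_nonneg divide_right_mono; simp)+
  moreover have "expansion B d = real (radix B d n) / real B ^ n + ?e"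
    using assms by (rule expansion_split)
  moreover have "(real (radix B d n) + 1) / real B ^ n =
      real (radix B d n) / real B ^ n + 1 / real B ^ n"
    by (rule add_divide_distrib)
  ultimately show "real (radix B d n) / real B ^ n \<le> expansion B d"
    "expansion B d \<le> (real (radix B d n) + 1) / real B ^ n"
    by linarith+
qed


section \<open>Weighted trees and power sums\<close>

text \<open>Let the weight of each vertex of a tree be at most the total weight of its children. A set of
  vertices that every infinite branch meets then weighs at least as much as the root: otherwise
  the part of \<open>T\<close> below the root is too light, hence so is the part of \<open>T\<close> below some child, and so
  on, and the resulting branch avoids \<open>T\<close>, as the part of \<open>T\<close> below a vertex of \<open>T\<close> is not too light.
  This replaces a Frostman measure and needs no compactness.\<close>

lemma branch_avoiding:
  fixes w :: "'v \<Rightarrow> ennreal"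
  assumes root: "v0 \<in> V"
    and child: "\<And>v. v \<in> V \<Longrightarrow> finite (child v) \<and> child v \<subseteq> V"
    and w: "\<And>v. v \<in> V \<Longrightarrow> w v \<le> (\<Sum>c\<in>child v. w c)"
    and sub: "\<And>v c. v \<in> V \<Longrightarrow> c \<in> child v \<Longrightarrow> below c \<subseteq> below v"
    and disj: "\<And>v. v \<in> V \<Longrightarrow> disjoint_family_on below (child v)"
    and refl: "\<And>v. v \<in> V \<Longrightarrow> v \<in> below v"
    and small: "emeasure (point_measure UNIV w) T < w v0"
  obtains \<xi> where "\<xi> 0 = v0" "\<And>g. \<xi> (Suc g) \<in> child (\<xi> g)" "\<And>g::nat. \<xi> g \<in> V - T"
proof -
  define W where "W v = emeasure (point_measure UNIV w) (T \<inter> below v)" for v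
  have W_mono: "emeasure (point_measure UNIV w) X \<le> emeasure (point_measure UNIV w) Y"
    if "X \<subseteq> Y" for X Y
    using that by (intro emeasure_mono) (auto simp: sets_point_measure)
  have step: "\<exists>c\<in>child v. W c < w c" if v: "v \<in> V" "W v < w v" for v
  proof (rule ccontr)
    assume "\<not> ?thesis"
    then have "(\<Sum>c\<in>child v. w c) \<le> (\<Sum>c\<in>child v. W c)"
      by (intro sum_mono) (auto simp: not_less)
    also have "\<dots> = emeasure (point_measure UNIV w) (\<Union>c\<in>child v. T \<inter> below c)"
      unfolding W_def using disj[OF v(1)] child[OF v(1)]
      by (intro sum_emeasure) (auto simp: sets_point_measure disjoint_family_on_def)
    also have "\<dots> \<le> W v"
      unfolding W_def using sub[OF v(1)] by (intro W_mono) blast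
    finally show False
      using w[OF v(1)] v(2) by auto
  qed
  have "\<exists>\<xi>. \<forall>n::nat. ((\<xi> n \<in> V \<and> W (\<xi> n) < w (\<xi> n)) \<and> (n = 0 \<longrightarrow> \<xi> n = v0)) \<and> \<xi> (Suc n) \<in> child (\<xi> n)"
  proof (rule dependent_nat_choice)
    have "W v0 < w v0"
      using small W_mono[of "T \<inter> below v0" T] unfolding W_def by (meson inf_le1 le_less_trans)
    then show "\<exists>v. (v \<in> V \<and> W v < w v) \<and> (0 = (0::nat) \<longrightarrow> v = v0)"
      using root by blast
  qed (use step child in blast)
  then obtain \<xi> where \<xi>: "\<And>n::nat. \<xi> n \<in> V" "\<And>n. W (\<xi> n) < w (\<xi> n)" "\<xi> 0 = v0"
    "\<And>n. \<xi> (Suc n) \<in> child (\<xi> n)"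
    by blast
  have "\<xi> g \<notin> T" for g
  proof
    assume "\<xi> g \<in> T"
    then have "emeasure (point_measure UNIV w) {\<xi> g} \<le> W (\<xi> g)"
      unfolding W_def using refl \<xi>(1) by (intro W_mono) auto
    then show False
      using \<xi>(2)[of g] by (simp add: emeasure_point_measure_finite2)
  qed
  then show ?thesis
    using \<xi> by (intro that[of \<xi>]) auto
qed

text \<open>Up to the constant \<open>2 powr Q\<close> this is the power mean inequality. A common value \<open>\<theta>\<close> of the
  terms that is half their guaranteed average lets the terms below \<open>\<theta>\<close> be discarded.\<close>

lemma sum_powr_ge:
  fixes d :: "'i \<Rightarrow> real"
  assumes "\<And>j. j \<in> J \<Longrightarrow> 0 \<le> d j" "real (card J) \<le> L" "0 < L" "1 \<le> Q" "0 \<le> S" "S \<le> (\<Sum>j\<in>J. d j)"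
  shows "S / 2 * (S / (2 * L)) powr (Q - 1) \<le> (\<Sum>j\<in>J. d j powr Q)"
proof -
  define \<theta> where "\<theta> = S / (2 * L)"
  have \<theta>: "0 \<le> \<theta>"
    using assms by (simp add: \<theta>_def)
  have tangent: "(x - \<theta>) * \<theta> powr (Q - 1) \<le> x powr Q" if "0 \<le> x" for x
  proof (cases "\<theta> \<le> x")
    case True
    have "(x - \<theta>) * \<theta> powr (Q - 1) \<le> x * x powr (Q - 1)"
      using True \<theta> assms(4) by (intro mult_mono powr_mono2) auto
    also have "\<dots> = x powr Q"
      using that by (cases "x = 0") (auto simp: powr_mult_base)
    finally show ?thesis .
  next
    case False
    then have "(x - \<theta>) * \<theta> powr (Q - 1) \<le> 0"
      by (intro mult_nonpos_nonneg) auto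
    then show ?thesis
      by (meson order_trans powr_ge_zero)
  qed
  have "real (card J) * \<theta> \<le> L * \<theta>"
    using assms(2) \<theta> by (rule mult_right_mono)
  also have "\<dots> = S / 2"
    using assms(3) by (simp add: \<theta>_def)
  finally have "S / 2 \<le> (\<Sum>j\<in>J. d j - \<theta>)"
    using assms(6) by (simp add: sum_subtractf)
  then have "S / 2 * \<theta> powr (Q - 1) \<le> (\<Sum>j\<in>J. d j - \<theta>) * \<theta> powr (Q - 1)"
    by (intro mult_right_mono) auto
  also have "\<dots> \<le> (\<Sum>j\<in>J. d j powr Q)"
    unfolding sum_distrib_right using assms(1) by (intro sum_mono tangent)
  finally show ?thesis
    by (simp add: \<theta>_def)
qed


section \<open>Distances distorted by quasisymmetric maps\<close>

text \<open>A metric \<open>D\<close> on \<open>S\<close>, thought of as the metric of a quasisymmetric image pulled back to \<open>S\<close>. Of the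
  control function only two features are kept: it is locally bounded, and it tends to 0 at 0.\<close>

locale qs_distance =
  fixes S :: "'a::metric_space set" and D :: "'a \<Rightarrow> 'a \<Rightarrow> real"
  assumes D_nonneg: "0 \<le> D x y"
    and D_sym: "D x y = D y x"
    and D_triangle: "x \<in> S \<Longrightarrow> y \<in> S \<Longrightarrow> z \<in> S \<Longrightarrow> D x z \<le> D x y + D y z"
    and D_pos: "x \<in> S \<Longrightarrow> y \<in> S \<Longrightarrow> x \<noteq> y \<Longrightarrow> 0 < D x y"
    and weakly_qs: "\<exists>C>0. \<forall>x\<in>S. \<forall>y\<in>S. \<forall>z\<in>S. dist x y \<le> A * dist x z \<longrightarrow> D x y \<le> C * D x z"
    and small_ratio:
      "0 < \<epsilon> \<Longrightarrow> \<exists>\<delta>>0. \<forall>x\<in>S. \<forall>y\<in>S. \<forall>z\<in>S. dist x y \<le> \<delta> * dist x z \<longrightarrow> D x y \<le> \<epsilon> * D x z"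
begin

lemma D_self: "x \<in> S \<Longrightarrow> D x x = 0"
  using small_ratio[of "1 / 2"] D_nonneg[of x x] by fastforce

text \<open>The next three lemmas transfer distances at one scale \<open>\<rho>\<close>. A pair \<open>u, v\<close> at distance at least \<open>\<rho>\<close>
  serves as a yardstick: the \<open>D\<close>-size of a configuration near \<open>u\<close> of diameter about \<open>\<rho>\<close> is at most a
  constant times \<open>D u v\<close>, a much smaller configuration has much smaller \<open>D\<close>-size, and points
  \<open>D\<close>-closer than \<open>u\<close> and \<open>v\<close> are at distance \<open>O(\<rho>)\<close>.\<close>

lemma comparable:
  obtains C where "0 < C"
    "\<And>\<rho> x y u v. \<lbrakk>x \<in> S; y \<in> S; u \<in> S; v \<in> S; 0 < \<rho>; \<rho> \<le> dist u v; dist u x \<le> A * \<rho>; dist u y \<le> A * \<rho>\<rbrakk>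
       \<Longrightarrow> D x y \<le> C * D u v"
proof -
  obtain C where C: "C > 0"
    "\<And>x y z. x \<in> S \<Longrightarrow> y \<in> S \<Longrightarrow> z \<in> S \<Longrightarrow> dist x y \<le> max A 0 * dist x z \<Longrightarrow> D x y \<le> C * D x z"
    using weakly_qs[of "max A 0"] by blast
  show ?thesis
  proof (rule that[of "2 * C"])
    fix \<rho> :: real and x y u v
    assume *: "x \<in> S" "y \<in> S" "u \<in> S" "v \<in> S" "0 < \<rho>" "\<rho> \<le> dist u v"
      "dist u x \<le> A * \<rho>" "dist u y \<le> A * \<rho>"
    have "D u t \<le> C * D u v" if "t \<in> S" "dist u t \<le> A * \<rho>" for t
    proof (rule C(2))
      have "A * \<rho> \<le> max A 0 * dist u v"
        using * by (intro mult_mono) auto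
      then show "dist u t \<le> max A 0 * dist u v"
        using that by linarith
    qed (use * that in auto)
    from this[of x] this[of y] show "D x y \<le> 2 * C * D u v"
      using * D_triangle[of x u y] D_sym[of x u] by simp
  qed (use C(1) in auto)
qed

lemma comparable_small:
  assumes "0 < \<epsilon>"
  obtains \<delta> where "0 < \<delta>"
    "\<And>\<rho> x y u v. \<lbrakk>x \<in> S; y \<in> S; u \<in> S; v \<in> S; 0 < \<rho>; \<rho> \<le> dist u v; dist u x \<le> A * \<rho>; dist x y \<le> \<delta> * \<rho>\<rbrakk>
       \<Longrightarrow> D x y \<le> \<epsilon> * D u v"
proof -
  obtain C where C: "C > 0"
    "\<And>x y z. x \<in> S \<Longrightarrow> y \<in> S \<Longrightarrow> z \<in> S \<Longrightarrow> dist x y \<le> max A 0 * dist x z \<Longrightarrow> D x y \<le> C * D x z"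
    using weakly_qs[of "max A 0"] by blast
  have \<epsilon>': "0 < \<epsilon> / (C + 1)"
    using assms C(1) by simp
  obtain \<delta> where \<delta>: "\<delta> > 0"
    "\<And>x y z. x \<in> S \<Longrightarrow> y \<in> S \<Longrightarrow> z \<in> S \<Longrightarrow> dist x y \<le> \<delta> * dist x z \<Longrightarrow> D x y \<le> \<epsilon> / (C + 1) * D x z"
    using small_ratio[OF \<epsilon>'] by blast
  show ?thesis
  proof (rule that[of "\<delta> / 2"])
    fix \<rho> :: real and x y u v
    assume *: "x \<in> S" "y \<in> S" "u \<in> S" "v \<in> S" "0 < \<rho>" "\<rho> \<le> dist u v"
      "dist u x \<le> A * \<rho>" "dist x y \<le> \<delta> / 2 * \<rho>"
    have "A * \<rho> \<le> max A 0 * dist u v"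
      using * by (intro mult_mono) auto
    then have Du: "D u x \<le> C * D u v"
      using * by (intro C(2)) auto
    \<comment> \<open>One of \<open>u\<close>, \<open>v\<close> is at distance at least \<open>\<rho> / 2\<close> from \<open>x\<close> and is compared with \<open>y\<close>.\<close>
    have "\<exists>z. z \<in> S \<and> \<rho> / 2 \<le> dist x z \<and> D x z \<le> (C + 1) * D u v"
    proof (cases "\<rho> / 2 \<le> dist x u")
      case True
      then show ?thesis
        using * Du D_sym[of x u] D_nonneg[of u v] by (intro exI[of _ u]) (auto simp: algebra_simps)
    next
      case False
      then have "\<rho> / 2 \<le> dist x v"
        using * dist_triangle[of u v x] by (simp add: dist_commute)
      then show ?thesis
        using * Du D_sym[of x u] D_triangle[of x u v] by (intro exI[of _ v]) (auto simp: algebra_simps)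
    qed
    then obtain z where z: "z \<in> S" "\<rho> / 2 \<le> dist x z" "D x z \<le> (C + 1) * D u v"
      by blast
    have "\<delta> * (\<rho> / 2) \<le> \<delta> * dist x z"
      using z(2) \<delta>(1) by (intro mult_left_mono) auto
    then have "D x y \<le> \<epsilon> / (C + 1) * D x z"
      using * z by (intro \<delta>(2)) auto
    also have "\<dots> \<le> \<epsilon> / (C + 1) * ((C + 1) * D u v)"
      using z(3) assms C(1) by (intro mult_left_mono) auto
    also have "\<dots> = \<epsilon> * D u v"
      using C(1) by simp
    finally show "D x y \<le> \<epsilon> * D u v" .
  qed (use \<delta>(1) in auto)
qed

lemma comparable_inverse:
  assumes "0 < A"
  obtains C where "0 < C"
    "\<And>\<rho> x y u v. \<lbrakk>x \<in> S; y \<in> S; u \<in> S; v \<in> S; u \<noteq> v; dist x u \<le> A * \<rho>; dist x v \<le> A * \<rho>; D x y \<le> D u v\<rbrakk>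
       \<Longrightarrow> dist x y \<le> C * \<rho>"
proof -
  obtain \<delta> where \<delta>: "\<delta> > 0"
    "\<And>x y z. x \<in> S \<Longrightarrow> y \<in> S \<Longrightarrow> z \<in> S \<Longrightarrow> dist x y \<le> \<delta> * dist x z \<Longrightarrow> D x y \<le> 1 / 3 * D x z"
    using small_ratio[of "1 / 3"] by auto
  show ?thesis
  proof (rule that[of "A / \<delta>"])
    fix \<rho> :: real and x y u v
    assume *: "x \<in> S" "y \<in> S" "u \<in> S" "v \<in> S" "u \<noteq> v"
      "dist x u \<le> A * \<rho>" "dist x v \<le> A * \<rho>" "D x y \<le> D u v"
    show "dist x y \<le> A / \<delta> * \<rho>"
    proof (rule ccontr)
      assume "\<not> ?thesis"
      then have "A * \<rho> \<le> \<delta> * dist x y"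
        using \<delta>(1) by (simp add: field_simps)
      then have "D x u \<le> 1 / 3 * D x y" "D x v \<le> 1 / 3 * D x y"
        using * by (intro \<delta>(2); linarith)+
      then show False
        using * D_triangle[of u x v] D_sym[of u x] D_pos[of u v] by simp
    qed
  qed (use \<delta>(1) assms in auto)
qed

end

lemma qs_distance_of_quasisymmetric:
  fixes S :: "'a::metric_space set"
  assumes "quasisymmetric (submetric euclidean_metric S) Y f"
  shows "qs_distance S (\<lambda>x y. mdist Y (f x) (f y))" and "f ` S = mspace Y"
proof -
  have hom: "homeomorphic_map (mtopology_of (submetric euclidean_metric S)) (mtopology_of Y) f"
    using assms by (simp add: quasisymmetric_def)
  have inj: "inj_on f S"
    using homeomorphic_imp_injective_map[OF hom] by simp
  show im: "f ` S = mspace Y"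
    using homeomorphic_imp_surjective_map[OF hom] by simp
  obtain \<eta> :: "real \<Rightarrow> real" where \<eta>: "homeomorphic_map (top_of_set {0..}) (top_of_set {0..}) \<eta>"
    and qs: "\<And>x y z. x \<in> S \<Longrightarrow> y \<in> S \<Longrightarrow> z \<in> S \<Longrightarrow> x \<noteq> z \<Longrightarrow>
           mdist Y (f x) (f y) / mdist Y (f x) (f z) \<le> \<eta> (dist x y / dist x z)"
    using assms unfolding quasisymmetric_def by auto
  have cont: "continuous_on {0..} \<eta>"
    using homeomorphic_imp_continuous_map[OF \<eta>] by simp
  have \<eta>_inj: "inj_on \<eta> {0..}"
    using homeomorphic_imp_injective_map[OF \<eta>] by simp
  have \<eta>_im: "\<eta> ` {0..} = {0..}"
    using homeomorphic_imp_surjective_map[OF \<eta>] by simp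
  have \<eta>_ge: "0 \<le> \<eta> t" if "0 \<le> t" for t
    using \<eta>_im that by (metis atLeast_iff imageI)
  obtain a where a: "0 \<le> a" "\<eta> a = 0"
    using \<eta>_im by (metis atLeast_iff imageE order_refl)
  \<comment> \<open>A homeomorphism of the half-line is strictly monotone, and a decreasing map could not attain the least value 0.\<close>
  have \<eta>0: "\<eta> 0 = 0"
  proof -
    have "strict_mono_on {0..} \<eta> \<or> strict_antimono_on {0..} \<eta>"
      using injective_eq_monotone_map[of "{0..}" \<eta>] cont \<eta>_inj by (simp add: is_interval_ci)
    moreover have "\<not> strict_antimono_on {0..} \<eta>"
      using monotone_onD[of "{0..}" "(<)" "(>)" \<eta> a "a + 1"] a \<eta>_ge[of "a + 1"] by auto
    ultimately have "strict_mono_on {0..} \<eta>"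
      by blast
    then have "\<eta> 0 \<le> \<eta> a"
      using a by (cases "a = 0") (auto dest: strict_mono_onD[of _ _ 0 a])
    then show ?thesis
      using a \<eta>_ge[of 0] by simp
  qed
  have Ypos: "0 < mdist Y (f x) (f z)" if "x \<in> S" "z \<in> S" "x \<noteq> z" for x z
  proof -
    have "f x \<noteq> f z" "f x \<in> mspace Y" "f z \<in> mspace Y"
      using that inj im by (auto dest: inj_onD)
    then show ?thesis
      by (metis mdist_nonneg mdist_zero less_le)
  qed
  have key: "mdist Y (f x) (f y) \<le> C * mdist Y (f x) (f z)"
    if "x \<in> S" "y \<in> S" "z \<in> S" "0 \<le> A" "dist x y \<le> A * dist x z" "\<And>t. 0 \<le> t \<Longrightarrow> t \<le> A \<Longrightarrow> \<eta> t \<le> C"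
      "0 \<le> C"
    for x y z A C
  proof (cases "x = z")
    case True
    then have "y = x"
      using that by simp
    moreover have "mdist Y (f x) (f x) = 0"
      using that(1) im by (subst mdist_zero) auto
    ultimately show ?thesis
      using True by simp
  next
    case False
    then have "mdist Y (f x) (f y) / mdist Y (f x) (f z) \<le> \<eta> (dist x y / dist x z)"
      using that qs by blast
    also have "\<dots> \<le> C"
      using that False by (intro that(6)) (auto simp: field_simps)
    finally show ?thesis
      using Ypos[of x z] that False by (simp add: field_simps)
  qed
  show "qs_distance S (\<lambda>x y. mdist Y (f x) (f y))"
  proof
    show "mdist Y (f x) (f y) = mdist Y (f y) (f x)" for x y
      by (rule mdist_commute)
    show "mdist Y (f x) (f z) \<le> mdist Y (f x) (f y) + mdist Y (f y) (f z)"
      if "x \<in> S" "y \<in> S" "z \<in> S" for x y z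
      using that im by (intro mdist_triangle) auto
    show "\<exists>C>0. \<forall>x\<in>S. \<forall>y\<in>S. \<forall>z\<in>S. dist x y \<le> A * dist x z \<longrightarrow>
        mdist Y (f x) (f y) \<le> C * mdist Y (f x) (f z)" for A
    proof -
      have "compact (\<eta> ` {0..max A 0})"
        by (intro compact_continuous_image continuous_on_subset[OF cont]) auto
      then obtain C where C: "\<And>t. 0 \<le> t \<Longrightarrow> t \<le> max A 0 \<Longrightarrow> \<bar>\<eta> t\<bar> \<le> C"
        by (force dest!: compact_imp_bounded simp: bounded_iff)
      have "mdist Y (f x) (f y) \<le> max C 1 * mdist Y (f x) (f z)"
        if "x \<in> S" "y \<in> S" "z \<in> S" "dist x y \<le> A * dist x z" for x y z
      proof (rule key[where A = "max A 0"])
        have "A * dist x z \<le> max A 0 * dist x z"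
          by (intro mult_right_mono) auto
        then show "dist x y \<le> max A 0 * dist x z"
          using that by linarith
        show "\<eta> t \<le> max C 1" if "0 \<le> t" "t \<le> max A 0" for t
          using C[of t] that by linarith
      qed (use that in auto)
      then show ?thesis
        by (intro exI[of _ "max C 1"]) auto
    qed
    show "\<exists>\<delta>>0. \<forall>x\<in>S. \<forall>y\<in>S. \<forall>z\<in>S. dist x y \<le> \<delta> * dist x z \<longrightarrow>
        mdist Y (f x) (f y) \<le> \<epsilon> * mdist Y (f x) (f z)" if \<epsilon>: "0 < \<epsilon>" for \<epsilon>
    proof -
      obtain \<delta> where \<delta>: "\<delta> > 0" "\<And>t. t \<in> {0..} \<Longrightarrow> dist t 0 < \<delta> \<Longrightarrow> dist (\<eta> t) (\<eta> 0) < \<epsilon>"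
        using cont \<epsilon> unfolding continuous_on_iff by (metis atLeast_iff order_refl)
      have "\<eta> t \<le> \<epsilon>" if "0 \<le> t" "t \<le> \<delta> / 2" for t
        using \<delta>(2)[of t] \<delta>(1) that \<eta>0 by (simp add: dist_real_def)
      then have "mdist Y (f x) (f y) \<le> \<epsilon> * mdist Y (f x) (f z)"
        if "x \<in> S" "y \<in> S" "z \<in> S" "dist x y \<le> \<delta> / 2 * dist x z" for x y z
        using that \<delta>(1) \<epsilon> by (intro key[where A = "\<delta> / 2"]) auto
      then show ?thesis
        using \<delta>(1) by (intro exI[of _ "\<delta> / 2"]) auto
    qed
  qed (use Ypos in auto)
qed


section \<open>Coding the carpet by approximate squares\<close>

lemma card_image_le_card_image:
  assumes "finite (g ` A)" "\<And>a a'. a \<in> A \<Longrightarrow> a' \<in> A \<Longrightarrow> g a = g a' \<Longrightarrow> f a = f a'"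
  shows "finite (f ` A)" "card (f ` A) \<le> card (g ` A)"
proof -
  have "f ` A = (\<lambda>i. f (inv_into A g i)) ` (g ` A)"
    unfolding image_image using assms(2)
    by (intro image_cong refl) (metis f_inv_into_f imageI inv_into_into)
  then show "finite (f ` A)" "card (f ` A) \<le> card (g ` A)"
    using assms(1) by (simp_all only: finite_imageI card_image_le)
qed

lemma card_nat_near:
  fixes z R :: real
  assumes "0 \<le> R"
  shows "finite {i::nat. \<bar>real i - z\<bar> \<le> R}" "real (card {i::nat. \<bar>real i - z\<bar> \<le> R}) \<le> 2 * R + 1"
proof -
  let ?I = "{\<lceil>z - R\<rceil>..\<lfloor>z + R\<rfloor>}"
  have sub: "{i::nat. \<bar>real i - z\<bar> \<le> R} \<subseteq> nat ` ?I"
  proof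
    fix i :: nat
    assume "i \<in> {i. \<bar>real i - z\<bar> \<le> R}"
    then have "int i \<in> ?I"
      by (auto simp: ceiling_le_iff le_floor_iff)
    then show "i \<in> nat ` ?I"
      by (intro image_eqI[of _ _ "int i"]) auto
  qed
  then show "finite {i::nat. \<bar>real i - z\<bar> \<le> R}"
    by (rule finite_subset) simp
  have "card {i::nat. \<bar>real i - z\<bar> \<le> R} \<le> card ?I"
    using card_mono[OF _ sub] card_image_le[of ?I nat] by simp
  then have "real (card {i::nat. \<bar>real i - z\<bar> \<le> R}) \<le> real (nat (\<lfloor>z + R\<rfloor> - \<lceil>z - R\<rceil> + 1))"
    by simp
  also have "\<dots> \<le> 2 * R + 1"
    using assms of_int_floor_le[of "z + R"] le_of_int_ceiling[of "z - R"] by linarith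
  finally show "real (card {i::nat. \<bar>real i - z\<bar> \<le> R}) \<le> 2 * R + 1" .
qed

text \<open>A pattern with \<open>N\<close> elements in every row. The map \<open>col b\<close> enumerates the columns of row \<open>b\<close>; rows
  and columns are numbered from 0 here, hence the successors in the axioms about \<open>D\<close>.\<close>

locale uniform_carpet =
  fixes m l N :: nat and D :: "(nat \<times> nat) set" and col :: "nat \<Rightarrow> nat \<Rightarrow> nat"
  assumes l: "1 < l" and lm: "l < m" and N: "0 < N"
    and col_less: "b < l \<Longrightarrow> c < N \<Longrightarrow> col b c < m"
    and col_mem: "b < l \<Longrightarrow> c < N \<Longrightarrow> (Suc (col b c), Suc b) \<in> D"
    and col_inj: "b < l \<Longrightarrow> inj_on (col b) {..<N}"
    and col_surj: "(a, b) \<in> D \<Longrightarrow> \<exists>c<N. \<exists>b'<l. b = Suc b' \<and> a = Suc (col b' c)"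
begin

text \<open>A point of the carpet is coded by two independent sequences: \<open>b t\<close> is the row at generation \<open>t\<close>,
  and \<open>c t\<close> is the position, within that row, of the element of the pattern. The symbol space is
  therefore a product, although the carpet need not be one.\<close>

definition coded :: "(nat \<Rightarrow> nat) \<Rightarrow> (nat \<Rightarrow> nat) \<Rightarrow> bool" where
  "coded c b \<longleftrightarrow> (\<forall>t. c t < N) \<and> (\<forall>t. b t < l)"

text \<open>The horizontal base \<open>m\<close> digit, which depends on both sequences.\<close>

definition xdigit :: "(nat \<Rightarrow> nat) \<Rightarrow> (nat \<Rightarrow> nat) \<Rightarrow> nat \<Rightarrow> nat" where
  "xdigit c b t = col (b t) (c t)"

definition pt :: "(nat \<Rightarrow> nat) \<Rightarrow> (nat \<Rightarrow> nat) \<Rightarrow> real \<times> real" where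
  "pt c b = (expansion m (xdigit c b), expansion l b)"

text \<open>The first generation at which the height of rectangles is at most \<open>m\<^sup>-\<^sup>k\<close>; it is then at least
  \<open>m\<^sup>-\<^sup>k / l\<close>.\<close>

definition row_depth :: "nat \<Rightarrow> nat" where
  "row_depth k = (LEAST n. m ^ k \<le> l ^ n)"

text \<open>The approximate square of side \<open>m\<^sup>-\<^sup>k\<close> that contains a coded point. It fixes \<open>k\<close> of the digits \<open>c\<close>
  and \<^term>\<open>row_depth k\<close> of the digits \<open>b\<close>, and is given by the values of these two digit strings.\<close>

definition cell :: "nat \<Rightarrow> (nat \<Rightarrow> nat) \<Rightarrow> (nat \<Rightarrow> nat) \<Rightarrow> nat \<times> nat" where
  "cell k c b = (radix N c k, radix l b (row_depth k))"

lemma m: "1 < m"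
  using l lm by simp

lemma pow_le_row_depth: "m ^ k \<le> l ^ row_depth k"
proof -
  have "m ^ k \<le> l ^ (m ^ k)"
    using self_le_ge2_pow[of l "m ^ k"] l by simp
  then show ?thesis
    unfolding row_depth_def by (rule LeastI)
qed

lemma row_depth_pow_le: "l ^ row_depth k \<le> l * m ^ k"
proof (cases "row_depth k")
  case 0
  then show ?thesis using l m by simp
next
  case (Suc n)
  then have "\<not> m ^ k \<le> l ^ n"
    unfolding row_depth_def by (intro not_less_Least) simp
  then show ?thesis
    using Suc by simp
qed

lemma le_row_depth: "k \<le> row_depth k"
proof -
  have "l ^ k \<le> l ^ row_depth k"
    using pow_le_row_depth[of k] lm by (meson le_trans less_imp_le power_mono zero_le)
  then show ?thesis
    using l by simp
qed

lemma strict_mono_row_depth: "strict_mono row_depth"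
proof (rule strict_mono_Suc_iff[THEN iffD2], intro allI)
  fix k
  have "l ^ row_depth k \<le> l * m ^ k" by (rule row_depth_pow_le)
  also have "\<dots> < m ^ Suc k"
    using lm l by simp
  also have "\<dots> \<le> l ^ row_depth (Suc k)" by (rule pow_le_row_depth)
  finally show "row_depth k < row_depth (Suc k)"
    using l by simp
qed

lemma row_depth_mono: "k \<le> k' \<Longrightarrow> row_depth k \<le> row_depth k'"
  using strict_mono_row_depth by (simp add: strict_mono_less_eq)

lemma eventually_row_depth_ge: "\<exists>K. \<forall>k\<ge>K. k + i \<le> row_depth k"
proof -
  have "1 < real m / real l"
    using l lm by simp
  then obtain K where K: "real (l ^ i) < (real m / real l) ^ K"
    using real_arch_pow by blast
  have "k + i \<le> row_depth k" if "K \<le> k" for k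
  proof -
    have "(real m / real l) ^ K \<le> (real m / real l) ^ k"
      using that l lm by (intro power_increasing) auto
    then have "real (l ^ i) < (real m / real l) ^ k"
      using K by linarith
    then have "real (l ^ (k + i)) < real (m ^ k)"
      using l by (simp add: power_divide field_simps power_add)
    then have "l ^ (k + i) < l ^ row_depth k"
      using pow_le_row_depth[of k] by (simp only: of_nat_less_iff)
    then show ?thesis
      using l by simp
  qed
  then show ?thesis by blast
qed

lemma xdigit_less: "coded c b \<Longrightarrow> xdigit c b t < m"
  by (simp add: coded_def xdigit_def col_less)

lemma fst_pt_bounds:
  assumes "coded c b"
  shows "real (radix m (xdigit c b) n) / real m ^ n \<le> fst (pt c b)"
    and "fst (pt c b) \<le> (real (radix m (xdigit c b) n) + 1) / real m ^ n"
  using expansion_bounds[of m "xdigit c b" n] m xdigit_less[OF assms] by (auto simp: pt_def)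

lemma snd_pt_bounds:
  assumes "coded c b"
  shows "real (radix l b n) / real l ^ n \<le> snd (pt c b)"
    and "snd (pt c b) \<le> (real (radix l b n) + 1) / real l ^ n"
  using expansion_bounds[of l b n] l assms by (auto simp: pt_def coded_def)

lemma corner_mem:
  assumes "coded c b"
  shows "(real (radix m (xdigit c b) n) / real m ^ n, real (radix l b n) / real l ^ n)
    \<in> carpet_corners m l D n"
proof (induction n)
  case (Suc n)
  have "(Suc (xdigit c b n), Suc (b n)) \<in> D"
    using assms by (simp add: coded_def xdigit_def col_mem)
  moreover have "real (radix B d (Suc n)) / real B ^ Suc n =
      real (radix B d n) / real B ^ n + (real (Suc (d n)) - 1) / real B ^ Suc n" if "1 < B" for B d
    using that by (simp add: field_simps)
  ultimately show ?case
    using Suc l m unfolding carpet_corners.simps by blast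
qed simp

lemma pt_in_carpet: "coded c b \<Longrightarrow> pt c b \<in> carpet m l D"
proof -
  assume cb: "coded c b"
  have "pt c b \<in> carpet_level m l D n" for n
    unfolding carpet_level_def
    using fst_pt_bounds[OF cb, of n] snd_pt_bounds[OF cb, of n] corner_mem[OF cb, of n]
    by (intro UN_I[OF corner_mem[OF cb, of n]])
      (auto simp: mem_Times_iff add_divide_distrib)
  then show ?thesis
    by (simp add: carpet_def)
qed

lemma corner_coded:
  assumes "(x, y) \<in> carpet_corners m l D n"
  shows "\<exists>c b. coded c b \<and> x = real (radix m (xdigit c b) n) / real m ^ n
    \<and> y = real (radix l b n) / real l ^ n"
  using assms
proof (induction n arbitrary: x y)
  case 0
  have "coded (\<lambda>_. 0) (\<lambda>_. 0)"
    using l N by (simp add: coded_def)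
  then show ?case
    using 0 by auto
next
  case (Suc n)
  then obtain x' y' a b0 where *: "(x', y') \<in> carpet_corners m l D n" "(a, b0) \<in> D"
    "x = x' + (real a - 1) / real m ^ Suc n" "y = y' + (real b0 - 1) / real l ^ Suc n"
    by auto
  obtain c b where cb: "coded c b" "x' = real (radix m (xdigit c b) n) / real m ^ n"
    "y' = real (radix l b n) / real l ^ n"
    using Suc.IH[OF *(1)] by blast
  obtain c' b' where new: "c' < N" "b' < l" "b0 = Suc b'" "a = Suc (col b' c')"
    using col_surj[OF *(2)] by blast
  let ?c = "c(n := c')" and ?b = "b(n := b')"
  have "coded ?c ?b"
    using cb(1) new by (simp add: coded_def)
  moreover have "radix m (xdigit ?c ?b) n = radix m (xdigit c b) n" "radix l ?b n = radix l b n"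
    by (intro radix_cong; simp add: xdigit_def)+
  then have "x = real (radix m (xdigit ?c ?b) (Suc n)) / real m ^ Suc n"
    "y = real (radix l ?b (Suc n)) / real l ^ Suc n"
    using *(3,4) cb new l m by (auto simp: xdigit_def field_simps)
  ultimately show ?case by blast
qed

lemma dist_le_sum: "dist p q \<le> \<bar>fst p - fst q\<bar> + \<bar>snd p - snd q\<bar>" for p q :: "real \<times> real"
  by (simp add: dist_prod_def dist_real_def sqrt_sum_squares_le_sum_abs)

lemma inverse_row_depth_le: "1 / real l ^ row_depth k \<le> 1 / real m ^ k"
proof -
  have "real m ^ k \<le> real l ^ row_depth k"
    using pow_le_row_depth[of k] by (metis of_nat_le_iff of_nat_power)
  then show ?thesis
    using m l by (intro divide_left_mono) auto
qed

lemma inverse_row_depth_ge: "1 / (real l * real m ^ k) \<le> 1 / real l ^ row_depth k"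
proof -
  have "real l ^ row_depth k \<le> real l * real m ^ k"
    using row_depth_pow_le[of k] by (metis of_nat_le_iff of_nat_mult of_nat_power)
  then show ?thesis
    using l m by (intro divide_left_mono) auto
qed

text \<open>Used both for two points of one cell and for points of two cells that are stacked on each other.\<close>

lemma dist_pt_le:
  assumes "coded c b" "coded c' b'" "\<And>t. t < k \<Longrightarrow> c t = c' t" "\<And>t. t < k \<Longrightarrow> b t = b' t"
    "\<bar>real (radix l b (row_depth k)) - real (radix l b' (row_depth k))\<bar> \<le> 1"
  shows "dist (pt c b) (pt c' b') \<le> 3 / real m ^ k"
proof -
  have "radix m (xdigit c b) k = radix m (xdigit c' b') k"
    using assms by (intro radix_cong) (simp add: xdigit_def)
  then have x: "\<bar>fst (pt c b) - fst (pt c' b')\<bar> \<le> 1 / real m ^ k"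
    using fst_pt_bounds[OF assms(1), of k] fst_pt_bounds[OF assms(2), of k]
    by (auto simp: add_divide_distrib)
  let ?L = "real l ^ row_depth k"
  have "\<bar>real (radix l b (row_depth k)) / ?L - real (radix l b' (row_depth k)) / ?L\<bar> \<le> 1 / ?L"
    using assms(5) l by (simp add: diff_divide_distrib[symmetric] abs_divide divide_right_mono)
  then have "\<bar>snd (pt c b) - snd (pt c' b')\<bar> \<le> 2 * (1 / ?L)"
    using snd_pt_bounds[OF assms(1), of "row_depth k"] snd_pt_bounds[OF assms(2), of "row_depth k"]
    unfolding add_divide_distrib by linarith
  then have "\<bar>snd (pt c b) - snd (pt c' b')\<bar> \<le> 2 / real m ^ k"
    using inverse_row_depth_le[of k] by simp
  then show ?thesis
    using x dist_le_sum[of "pt c b" "pt c' b'"] by simp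
qed

lemma cell_eqD:
  assumes "coded c b" "coded c' b'" "cell k c b = cell k c' b'"
  shows "t < k \<Longrightarrow> c t = c' t" "t < row_depth k \<Longrightarrow> b t = b' t"
  using assms radix_inj[of c N c' k t] radix_inj[of b l b' "row_depth k" t]
  by (auto simp: cell_def coded_def)

lemma cell_diameter:
  assumes "coded c b" "coded c' b'" "cell k c b = cell k c' b'"
  shows "dist (pt c b) (pt c' b') \<le> 3 / real m ^ k"
proof (rule dist_pt_le[OF assms(1,2)])
  show "c t = c' t" "b t = b' t" if "t < k" for t
    using cell_eqD[OF assms, of t] that le_row_depth[of k] by auto
qed (use assms(3) in \<open>simp add: cell_def\<close>)

text \<open>Two points of the cell \<open>(u, j)\<close> whose distance is comparable with the size of the cell: the first
  is on its lower edge, and the second has a height greater by at least the fraction \<open>1 / l\<close>.\<close>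

definition low_pt :: "nat \<Rightarrow> nat \<Rightarrow> nat \<Rightarrow> real \<times> real" where
  "low_pt k u j = pt (digits N k u 0) (digits l (row_depth k) j 0)"

definition high_pt :: "nat \<Rightarrow> nat \<Rightarrow> nat \<Rightarrow> real \<times> real" where
  "high_pt k u j = pt (digits N k u 0) (digits l (row_depth k) j 1)"

lemma coded_digits: "s < l \<Longrightarrow> coded (digits N k u 0) (digits l n j s)"
  using N by (simp add: coded_def digits_less)

lemma cell_digits:
  "u < N ^ k \<Longrightarrow> j < l ^ row_depth k \<Longrightarrow> cell k (digits N k u 0) (digits l (row_depth k) j s) = (u, j)"
  by (simp add: cell_def radix_digits)

lemma low_high_in_carpet: "low_pt k u j \<in> carpet m l D" "high_pt k u j \<in> carpet m l D"
  unfolding low_pt_def high_pt_def using l by (intro pt_in_carpet coded_digits; simp)+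

lemma dist_low_pt:
  assumes "coded c b" "cell k c b = (u, j)"
  shows "dist (low_pt k u j) (pt c b) \<le> 3 / real m ^ k"
proof -
  have "u < N ^ k" "j < l ^ row_depth k"
    using assms radix_less[of c N k] radix_less[of b l "row_depth k"] by (auto simp: cell_def coded_def)
  then show ?thesis
    unfolding low_pt_def using assms l
    by (intro cell_diameter coded_digits) (auto simp: cell_digits)
qed

lemma dist_high_pt:
  assumes "coded c b" "cell k c b = (u, j)"
  shows "dist (high_pt k u j) (pt c b) \<le> 3 / real m ^ k"
proof -
  have "u < N ^ k" "j < l ^ row_depth k"
    using assms radix_less[of c N k] radix_less[of b l "row_depth k"] by (auto simp: cell_def coded_def)
  then show ?thesis
    unfolding high_pt_def using assms l
    by (intro cell_diameter coded_digits) (auto simp: cell_digits)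
qed

lemma snd_low_pt:
  assumes "j < l ^ row_depth k"
  shows "snd (low_pt k u j) = real j / real l ^ row_depth k"
proof -
  have "expansion l (\<lambda>t. digits l (row_depth k) j 0 (t + row_depth k)) = 0"
    by (simp add: expansion_def digits_def)
  then show ?thesis
    using expansion_split[of l "digits l (row_depth k) j 0" "row_depth k"] l assms
    by (simp add: low_pt_def pt_def digits_less radix_digits)
qed

lemma dist_low_high:
  assumes "j < l ^ row_depth k"
  shows "1 / real l ^ 2 * (1 / real m ^ k) \<le> dist (low_pt k u j) (high_pt k u j)"
proof -
  have "1 / real l \<le> expansion l (\<lambda>t. digits l (row_depth k) j 1 (t + row_depth k))"
    using expansion_ge_first[of l "\<lambda>t. digits l (row_depth k) j 1 (t + row_depth k)"] l
    by (simp add: digits_less) (simp add: digits_def)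
  then have "1 / real l / real l ^ row_depth k
      \<le> expansion l (\<lambda>t. digits l (row_depth k) j 1 (t + row_depth k)) / real l ^ row_depth k"
    by (intro divide_right_mono) auto
  then have "real j / real l ^ row_depth k + 1 / real l / real l ^ row_depth k \<le> snd (high_pt k u j)"
    using expansion_split[of l "digits l (row_depth k) j 1" "row_depth k"] l assms
    by (simp add: high_pt_def pt_def digits_less radix_digits)
  then have "1 / real l * (1 / real l ^ row_depth k) \<le> dist (snd (low_pt k u j)) (snd (high_pt k u j))"
    using snd_low_pt[OF assms, of u] by (simp add: dist_real_def)
  moreover have "1 / real l * (1 / (real l * real m ^ k)) \<le> 1 / real l * (1 / real l ^ row_depth k)"
    using inverse_row_depth_ge[of k] by (intro mult_left_mono) auto
  ultimately show ?thesis
    using dist_snd_le[of "low_pt k u j" "high_pt k u j"] by (simp add: power2_eq_square)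
qed

text \<open>Vertically adjacent cells inside one larger cell lie above each other: since \<open>k + i \<le> row_depth k\<close>,
  the rows that influence the first \<open>k + i\<close> horizontal digits are already fixed by the larger cell.
  As \<open>l < m\<close>, that hypothesis holds for all large \<open>k\<close>.\<close>

lemma dist_low_Suc:
  assumes "k + i \<le> row_depth k" "u < N ^ (k + i)" "Suc j < l ^ row_depth (k + i)"
    "Suc j div l ^ (row_depth (k + i) - row_depth k) = j div l ^ (row_depth (k + i) - row_depth k)"
  shows "dist (low_pt (k + i) u j) (low_pt (k + i) u (Suc j)) \<le> 3 / real m ^ (k + i)"
  unfolding low_pt_def
proof (rule dist_pt_le)
  let ?b = "digits l (row_depth (k + i)) j 0" and ?b' = "digits l (row_depth (k + i)) (Suc j) 0"
  show coded: "coded (digits N (k + i) u 0) ?b" "coded (digits N (k + i) u 0) ?b'"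
    using l by (simp_all add: coded_digits)
  have "row_depth k \<le> row_depth (k + i)"
    by (simp add: row_depth_mono)
  then have "radix l ?b (row_depth k) = radix l ?b' (row_depth k)"
    using assms by (simp add: radix_digits_prefix)
  then show "?b t = ?b' t" if "t < k + i" for t
    using that assms(1) coded by (intro radix_inj[of ?b l ?b' "row_depth k"]) (auto simp: coded_def)
  show "\<bar>real (radix l ?b (row_depth (k + i))) - real (radix l ?b' (row_depth (k + i)))\<bar> \<le> 1"
    using assms by (simp add: radix_digits)
qed simp

text \<open>A column of cells extends over a fixed proportion of the height of the cell containing it.\<close>

lemma dist_low_ends:
  assumes "0 < i" "j < l ^ row_depth k"
  defines "\<Delta> \<equiv> row_depth (k + i) - row_depth k"
  shows "1 / (2 * real l) * (1 / real m ^ k)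
    \<le> dist (low_pt (k + i) u (j * l ^ \<Delta>)) (low_pt (k + i) u (j * l ^ \<Delta> + (l ^ \<Delta> - 1)))"
proof -
  have \<Delta>: "row_depth (k + i) = row_depth k + \<Delta>" "0 < \<Delta>"
    using strict_monoD[OF strict_mono_row_depth, of k "k + i"] assms(1) by (simp_all add: \<Delta>_def)
  have *: "j * l ^ \<Delta> + l ^ \<Delta> \<le> l ^ row_depth k * l ^ \<Delta>"
    using assms(2) by (metis add.commute Suc_leI mult_Suc mult_le_mono1)
  then have j: "j * l ^ \<Delta> + (l ^ \<Delta> - 1) < l ^ row_depth (k + i)" "j * l ^ \<Delta> < l ^ row_depth (k + i)"
  proof -
    have "0 < l ^ \<Delta>"
      using l by simp
    then show "j * l ^ \<Delta> + (l ^ \<Delta> - 1) < l ^ row_depth (k + i)" "j * l ^ \<Delta> < l ^ row_depth (k + i)"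
      using * unfolding \<Delta>(1) power_add by linarith+
  qed
  have "2 \<le> l ^ \<Delta>"
    using self_le_power[of l \<Delta>] l \<Delta>(2) by linarith
  then have "real l ^ \<Delta> / 2 \<le> real (l ^ \<Delta> - 1)"
    by (simp add: of_nat_diff flip: of_nat_power)
  then have "real l ^ \<Delta> / 2 / real l ^ row_depth (k + i) \<le> real (l ^ \<Delta> - 1) / real l ^ row_depth (k + i)"
    by (intro divide_right_mono) auto
  also have "real l ^ \<Delta> / 2 / real l ^ row_depth (k + i) = 1 / 2 * (1 / real l ^ row_depth k)"
    using l by (simp add: \<Delta>(1) power_add)
  also have "real (l ^ \<Delta> - 1) / real l ^ row_depth (k + i) = dist (snd (low_pt (k + i) u (j * l ^ \<Delta>)))
      (snd (low_pt (k + i) u (j * l ^ \<Delta> + (l ^ \<Delta> - 1))))"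
    unfolding snd_low_pt[OF j(1)] snd_low_pt[OF j(2)] dist_real_def
    by (simp add: diff_divide_distrib[symmetric] del: of_nat_diff)
  also have "\<dots> \<le> dist (low_pt (k + i) u (j * l ^ \<Delta>)) (low_pt (k + i) u (j * l ^ \<Delta> + (l ^ \<Delta> - 1)))"
    by (rule dist_snd_le)
  finally have "1 / 2 * (1 / real l ^ row_depth k)
    \<le> dist (low_pt (k + i) u (j * l ^ \<Delta>)) (low_pt (k + i) u (j * l ^ \<Delta> + (l ^ \<Delta> - 1)))" .
  moreover have "1 / (2 * real l) * (1 / real m ^ k) = 1 / 2 * (1 / (real l * real m ^ k))"
    by simp
  ultimately show ?thesis
    using inverse_row_depth_ge[of k] by linarith
qed

text \<open>Boundedly many cells of one generation come close to a given point. Cells are counted through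
  the integer coordinates of their lower left corners, which determine the cell because the
  enumerations \<open>col b\<close> are injective.\<close>

lemma cells_near_point:
  assumes "0 \<le> R" "\<And>c b. (c, b) \<in> A \<Longrightarrow> coded c b \<and> dist z (pt c b) \<le> R / real m ^ k"
  shows "finite ((\<lambda>(c, b). cell k c b) ` A)"
    "real (card ((\<lambda>(c, b). cell k c b) ` A)) \<le> (2 * (R + 1) + 1) * (2 * (R * real l + 1) + 1)"
proof -
  let ?g = "\<lambda>(c, b). (radix m (xdigit c b) k, radix l b (row_depth k))"
  let ?I = "{i::nat. \<bar>real i - fst z * real m ^ k\<bar> \<le> R + 1}"
  let ?J = "{i::nat. \<bar>real i - snd z * real l ^ row_depth k\<bar> \<le> R * real l + 1}"
  have sub: "?g ` A \<subseteq> ?I \<times> ?J"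
  proof
    fix p assume "p \<in> ?g ` A"
    then obtain c b where cb: "(c, b) \<in> A" "p = ?g (c, b)"
      by auto
    note * = assms(2)[OF cb(1)]
    let ?i = "real (radix m (xdigit c b) k)" and ?j = "real (radix l b (row_depth k))"
    have near: "\<bar>r - t * B\<bar> \<le> C + 1"
      if "r / B \<le> s" "s \<le> (r + 1) / B" "\<bar>t - s\<bar> \<le> C / B" "0 < B" for r s t B C :: real
    proof -
      have "r \<le> s * B" "s * B \<le> r + 1" "\<bar>t - s\<bar> * B \<le> C"
        using that by (simp_all add: field_simps)
      moreover have "\<bar>t - s\<bar> * B = \<bar>t * B - s * B\<bar>"
        using that(4) by (metis abs_mult abs_of_pos left_diff_distrib)
      ultimately show ?thesis by linarith
    qed
    have "\<bar>?i - fst z * real m ^ k\<bar> \<le> R + 1"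
      using * fst_pt_bounds[of c b k] dist_fst_le[of z "pt c b"] m
      by (intro near[of _ _ "fst (pt c b)"]) (auto simp: dist_real_def)
    moreover have "\<bar>?j - snd z * real l ^ row_depth k\<bar> \<le> R * real l + 1"
    proof (rule near[of _ _ "snd (pt c b)"])
      have "R * real l * (1 / (real l * real m ^ k)) \<le> R * real l * (1 / real l ^ row_depth k)"
        using inverse_row_depth_ge[of k] assms(1) by (intro mult_left_mono) auto
      then have "R / real m ^ k \<le> R * real l / real l ^ row_depth k"
        using l by simp
      then show "\<bar>snd z - snd (pt c b)\<bar> \<le> R * real l / real l ^ row_depth k"
        using * dist_snd_le[of z "pt c b"] by (simp add: dist_real_def)
    qed (use * snd_pt_bounds[of c b "row_depth k"] l in auto)
    ultimately show "p \<in> ?I \<times> ?J"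
      using cb(2) by simp
  qed
  have R: "0 \<le> R + 1" "0 \<le> R * real l + 1"
    using assms(1) by auto
  have fin: "finite (?I \<times> ?J)"
    using card_nat_near(1)[OF R(1)] card_nat_near(1)[OF R(2)] by (rule finite_cartesian_product)
  have "real (card (?I \<times> ?J)) = real (card ?I) * real (card ?J)"
    by (simp add: card_cartesian_product)
  also have "\<dots> \<le> (2 * (R + 1) + 1) * (2 * (R * real l + 1) + 1)"
    using card_nat_near(2)[OF R(1)] card_nat_near(2)[OF R(2)] assms(1) by (intro mult_mono) auto
  finally have card: "real (card (?I \<times> ?J)) \<le> (2 * (R + 1) + 1) * (2 * (R * real l + 1) + 1)" .
  have eq: "cell k c b = cell k c' b'"
    if "(c, b) \<in> A" "(c', b') \<in> A" "?g (c, b) = ?g (c', b')" for c b c' b'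
  proof -
    have cb: "coded c b" "coded c' b'"
      using assms(2) that by auto
    have eqs: "radix m (xdigit c b) k = radix m (xdigit c' b') k"
      "radix l b (row_depth k) = radix l b' (row_depth k)"
      using that(3) by simp_all
    have b: "b t = b' t" if "t < k" for t
      using radix_inj[OF _ _ eqs(2)] cb that le_row_depth[of k] by (simp add: coded_def)
    have "c t = c' t" if "t < k" for t
    proof -
      have "xdigit c b t = xdigit c' b' t"
        using radix_inj[OF _ _ eqs(1) that] cb by (simp add: xdigit_less)
      then show ?thesis
        using cb b[OF that] col_inj[of "b t"] by (auto simp: xdigit_def coded_def dest: inj_onD)
    qed
    then have "radix N c k = radix N c' k"
      by (rule radix_cong)
    then show ?thesis
      using eqs(2) by (simp add: cell_def)
  qed
  have fg: "finite (?g ` A)"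
    using sub fin by (rule finite_subset)
  show "finite ((\<lambda>(c, b). cell k c b) ` A)"
    by (rule card_image_le_card_image(1)[OF fg]) (use eq in auto)
  have "card ((\<lambda>(c, b). cell k c b) ` A) \<le> card (?g ` A)"
    by (rule card_image_le_card_image(2)[OF fg]) (use eq in auto)
  also have "\<dots> \<le> card (?I \<times> ?J)"
    using fin sub by (rule card_mono)
  finally show "real (card ((\<lambda>(c, b). cell k c b) ` A)) \<le> (2 * (R + 1) + 1) * (2 * (R * real l + 1) + 1)"
    using card by linarith
qed

text \<open>The rectangle spanned by the cell \<open>(u, j)\<close>. Its left edge depends on \<open>j\<close> as well as on \<open>u\<close>. The digits
  that pad the two strings do not matter, as \<open>k \<le> row_depth k\<close>.\<close>

definition box :: "nat \<Rightarrow> nat \<Rightarrow> nat \<Rightarrow> (real \<times> real) set" where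
  "box k u j = (let i = radix m (xdigit (digits N k u 0) (digits l (row_depth k) j 0)) k in
     {real i / real m ^ k..(real i + 1) / real m ^ k} \<times>
     {real j / real l ^ row_depth k..(real j + 1) / real l ^ row_depth k})"

lemma carpet_subset_boxes:
  assumes "0 < k"
  shows "carpet m l D \<subseteq> (\<Union>u<N ^ k. \<Union>j<l ^ row_depth k. box k u j)"
proof
  fix p assume p: "p \<in> carpet m l D"
  define n where "n = row_depth k"
  have n: "0 < n" "k \<le> n"
    using assms le_row_depth[of k] by (auto simp: n_def)
  have "p \<in> carpet_level m l D n"
    using p n by (simp add: carpet_def)
  then obtain x y where xy: "(x, y) \<in> carpet_corners m l D n"
      "p \<in> {x..x + 1 / real m ^ n} \<times> {y..y + 1 / real l ^ n}"
    unfolding carpet_level_def by blast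
  obtain c b where cb: "coded c b" "x = real (radix m (xdigit c b) n) / real m ^ n"
    "y = real (radix l b n) / real l ^ n"
    using corner_coded[OF xy(1)] by blast
  define u j where "u = radix N c k" and "j = radix l b n"
  have uj: "u < N ^ k" "j < l ^ n"
    using cb(1) by (auto simp: u_def j_def coded_def intro: radix_less)
  let ?c = "digits N k u 0" and ?b = "digits l n j 0"
  have coded': "coded ?c ?b"
    using l by (simp add: coded_digits)
  have same: "cell k c b = cell k ?c ?b"
    using uj by (simp add: cell_def radix_digits n_def[symmetric] u_def[symmetric] j_def[symmetric])
  define i where "i = radix m (xdigit ?c ?b) k"
  have "i = radix m (xdigit c b) k"
    unfolding i_def using cell_eqD[OF cb(1) coded' same] n
    by (intro radix_cong) (simp add: xdigit_def n_def)
  also have "\<dots> = radix m (xdigit c b) (k + (n - k)) div m ^ (n - k)"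
    using xdigit_less[OF cb(1)] by (intro radix_div[symmetric])
  finally have i: "i = radix m (xdigit c b) n div m ^ (n - k)"
    using n by simp
  have pow: "real m ^ n = real m ^ (n - k) * real m ^ k"
    using n by (simp flip: power_add)
  have "i * m ^ (n - k) \<le> radix m (xdigit c b) n"
    unfolding i by (rule div_times_less_eq_dividend)
  then have lo: "real i * real m ^ (n - k) \<le> real (radix m (xdigit c b) n)"
    by (metis of_nat_le_iff of_nat_mult of_nat_power)
  have "radix m (xdigit c b) n < Suc i * m ^ (n - k)"
    unfolding i using m by (simp add: dividend_less_div_times add.commute)
  then have "radix m (xdigit c b) n + 1 \<le> (i + 1) * m ^ (n - k)"
    by simp
  then have "real (radix m (xdigit c b) n + 1) \<le> real ((i + 1) * m ^ (n - k))"
    by (simp only: of_nat_le_iff)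
  then have hi: "real (radix m (xdigit c b) n) + 1 \<le> (real i + 1) * real m ^ (n - k)"
    by (simp add: algebra_simps)
  have "real i / real m ^ k \<le> x"
    unfolding cb(2) pow using lo m by (simp add: field_simps)
  moreover have "x + 1 / real m ^ n \<le> (real i + 1) / real m ^ k"
  proof -
    have "x + 1 / real m ^ n = (real (radix m (xdigit c b) n) + 1) / real m ^ n"
      by (simp add: cb(2) add_divide_distrib)
    also have "\<dots> = (real (radix m (xdigit c b) n) + 1) / real m ^ (n - k) / real m ^ k"
      by (simp add: pow)
    also have "\<dots> \<le> (real i + 1) / real m ^ k"
      using hi m by (intro divide_right_mono) (simp_all add: pos_divide_le_eq)
    finally show ?thesis .
  qed
  ultimately have "p \<in> box k u j"
    using xy(2) cb(3)
    by (auto simp: box_def Let_def i_def n_def[symmetric] j_def[symmetric] add_divide_distrib)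
  then show "p \<in> (\<Union>u<N ^ k. \<Union>j<l ^ row_depth k. box k u j)"
    using uj by (auto simp: n_def)
qed

lemma dist_box_le:
  assumes "p \<in> box k u j" "q \<in> box k u j"
  shows "dist p q \<le> 2 / real m ^ k"
proof -
  have "\<bar>fst p - fst q\<bar> \<le> 1 / real m ^ k" "\<bar>snd p - snd q\<bar> \<le> 1 / real l ^ row_depth k"
    using assms by (auto simp: box_def Let_def mem_Times_iff add_divide_distrib)
  then show ?thesis
    using inverse_row_depth_le[of k] dist_le_sum[of p q] by simp
qed

end


section \<open>Sizes of approximate squares in a quasisymmetric image\<close>

lemma mem_block_iff:
  fixes x q n :: nat
  assumes "0 < n"
  shows "x \<in> {q * n..<Suc q * n} \<longleftrightarrow> x div n = q"
proof
  assume "x \<in> {q * n..<Suc q * n}"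
  then show "x div n = q"
    by (intro div_nat_eqI) (auto simp: mult.commute)
next
  assume "x div n = q"
  then show "x \<in> {q * n..<Suc q * n}"
    using dividend_less_div_times[OF assms, of x] div_times_less_eq_dividend[of x n] by auto
qed

context uniform_carpet
begin

text \<open>The exponent \<open>Q\<close> with \<open>m powr Q = N * m\<close>: generation \<open>k\<close> has between \<open>(N * m) ^ k\<close> and
  \<open>l * (N * m) ^ k\<close> cells.\<close>

definition carpet_dim :: real where
  "carpet_dim = 1 + log (real m) (real N)"

lemma carpet_dim_ge_1: "1 \<le> carpet_dim"
  using m N by (simp add: carpet_dim_def zero_le_log_cancel_iff)

lemma powr_carpet_dim: "(real m ^ i) powr (carpet_dim - 1) = real N ^ i"
proof -
  have "real m powr (carpet_dim - 1) = real N"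
    using m N by (simp add: carpet_dim_def)
  moreover have "(real m ^ i) powr (carpet_dim - 1) = (real m powr (carpet_dim - 1)) ^ i"
    by (induction i) (simp_all add: powr_mult)
  ultimately show ?thesis
    by simp
qed

end

text \<open>A carpet with a quasisymmetrically equivalent metric \<open>d\<close>.\<close>

locale uniform_carpet_qs = uniform_carpet m l N D col + qs_distance "carpet m l D" d
  for m l N :: nat and D and col and d
begin

text \<open>A substitute for the \<open>d\<close>-diameter of a cell, comparable with it and free of suprema.\<close>

definition osc :: "nat \<Rightarrow> nat \<times> nat \<Rightarrow> real" where
  "osc k v = d (low_pt k (fst v) (snd v)) (high_pt k (fst v) (snd v))"

text \<open>The cells of generation \<open>k + i\<close> inside the cell \<open>v\<close> of generation \<open>k\<close>. They form \<open>N ^ i\<close> columns.\<close>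

definition children :: "nat \<Rightarrow> nat \<Rightarrow> nat \<times> nat \<Rightarrow> (nat \<times> nat) set" where
  "children i k v = {fst v * N ^ i..<Suc (fst v) * N ^ i} \<times>
     {snd v * l ^ (row_depth (k + i) - row_depth k)..<Suc (snd v) * l ^ (row_depth (k + i) - row_depth k)}"

text \<open>All cells of generation \<open>k\<close>.\<close>

definition cells :: "nat \<Rightarrow> (nat \<times> nat) set" where
  "cells k = {..<N ^ k} \<times> {..<l ^ row_depth k}"

lemma cell_mem_cells: "coded c b \<Longrightarrow> cell k c b \<in> cells k"
  by (auto simp: cells_def cell_def coded_def intro: radix_less)

lemma finite_children: "finite (children i k v)"
  by (simp add: children_def)

lemma mem_children_iff:
  "w \<in> children i k v \<longleftrightarrow>
     fst w div N ^ i = fst v \<and> snd w div l ^ (row_depth (k + i) - row_depth k) = snd v"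
  using N l by (simp add: children_def mem_Times_iff mem_block_iff del: mult_Suc atLeastLessThan_iff)

lemma children_subset_cells:
  assumes "v \<in> cells k"
  shows "children i k v \<subseteq> cells (k + i)"
proof
  fix w assume "w \<in> children i k v"
  then have w: "fst w div N ^ i < N ^ k" "snd w div l ^ (row_depth (k + i) - row_depth k) < l ^ row_depth k"
    using assms by (auto simp: mem_children_iff cells_def)
  have "fst w < N ^ k * N ^ i" "snd w < l ^ row_depth k * l ^ (row_depth (k + i) - row_depth k)"
    using w N l by (simp_all add: div_less_iff_less_mult)
  then show "w \<in> cells (k + i)"
    using row_depth_mono[of k "k + i"] by (simp add: cells_def mem_Times_iff flip: power_add)
qed

lemma cell_in_children:
  assumes "coded c b"
  shows "cell (k + i) c b \<in> children i k (cell k c b)"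
proof -
  have "radix N c (k + i) div N ^ i = radix N c k"
    using assms by (intro radix_div) (simp add: coded_def)
  moreover have "radix l b (row_depth k + (row_depth (k + i) - row_depth k)) div l ^ (row_depth (k + i) - row_depth k)
      = radix l b (row_depth k)"
    using assms by (intro radix_div) (simp add: coded_def)
  ultimately show ?thesis
    using row_depth_mono[of k "k + i"] by (simp add: mem_children_iff cell_def)
qed

lemma obtain_code:
  assumes "v \<in> cells k"
  obtains c b where "coded c b" "cell k c b = v" "pt c b = low_pt k (fst v) (snd v)"
proof (rule that)
  show "coded (digits N k (fst v) 0) (digits l (row_depth k) (snd v) 0)"
    using l by (simp add: coded_digits)
  show "cell k (digits N k (fst v) 0) (digits l (row_depth k) (snd v) 0) = v"
    using assms by (simp add: cell_digits cells_def mem_Times_iff)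
qed (simp add: low_pt_def)

lemma osc_pos:
  assumes "v \<in> cells k"
  shows "0 < osc k v"
proof -
  have "0 < 1 / real l ^ 2 * (1 / real m ^ k)"
    using l m by simp
  also have "\<dots> \<le> dist (low_pt k (fst v) (snd v)) (high_pt k (fst v) (snd v))"
    using assms by (intro dist_low_high) (simp add: cells_def mem_Times_iff)
  finally show ?thesis
    unfolding osc_def by (intro D_pos low_high_in_carpet) auto
qed

lemma dist_low_high_cell:
  assumes "v \<in> cells k"
  shows "1 / real l ^ 2 * (1 / real m ^ k) \<le> dist (low_pt k (fst v) (snd v)) (high_pt k (fst v) (snd v))"
  using assms by (intro dist_low_high) (simp add: cells_def mem_Times_iff)

lemma dist_low_pt_cell: "coded c b \<Longrightarrow> cell k c b = v \<Longrightarrow> dist (low_pt k (fst v) (snd v)) (pt c b) \<le> 3 / real m ^ k"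
  and dist_high_pt_cell: "coded c b \<Longrightarrow> cell k c b = v \<Longrightarrow> dist (high_pt k (fst v) (snd v)) (pt c b) \<le> 3 / real m ^ k"
  by (intro dist_low_pt dist_high_pt; simp)+

text \<open>The cells of a column form a chain from the bottom of the larger cell almost to its top. By the
  triangle inequality their \<open>d\<close>-sizes add up to at least a constant multiple of the \<open>d\<close>-size of the
  larger cell. That the constant does not depend on \<open>i\<close> is essential.\<close>

lemma column_sum_ge:
  obtains \<gamma> where "0 < \<gamma>"
    "\<And>k i v u. \<lbrakk>0 < i; k + i \<le> row_depth k; v \<in> cells k; u div N ^ i = fst v\<rbrakk> \<Longrightarrow>
       \<gamma> * osc k v \<le>
       (\<Sum>j\<in>{snd v * l ^ (row_depth (k + i) - row_depth k)..<Suc (snd v) * l ^ (row_depth (k + i) - row_depth k)}.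
          osc (k + i) (u, j))"
proof -
  obtain C where C: "0 < C"
    "\<And>\<rho> x y u v. \<lbrakk>x \<in> carpet m l D; y \<in> carpet m l D; u \<in> carpet m l D; v \<in> carpet m l D; 0 < \<rho>;
       \<rho> \<le> dist u v; dist u x \<le> 6 * real l * \<rho>; dist u y \<le> 6 * real l * \<rho>\<rbrakk> \<Longrightarrow> d x y \<le> C * d u v"
    using comparable[of "6 * real l"] by metis
  obtain C' where C': "0 < C'"
    "\<And>\<rho> x y u v. \<lbrakk>x \<in> carpet m l D; y \<in> carpet m l D; u \<in> carpet m l D; v \<in> carpet m l D; 0 < \<rho>;
       \<rho> \<le> dist u v; dist u x \<le> 3 * real l ^ 2 * \<rho>; dist u y \<le> 3 * real l ^ 2 * \<rho>\<rbrakk> \<Longrightarrow> d x y \<le> C' * d u v"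
    using comparable[of "3 * real l ^ 2"] by metis
  show ?thesis
  proof (rule that[of "1 / (C * C')"])
    show "0 < 1 / (C * C')"
      using C(1) C'(1) by simp
  next
    fix k i v u
    assume i: "0 < i" and ki: "k + i \<le> row_depth k" and v: "v \<in> cells k" and u: "u div N ^ i = fst v"
    define \<Delta> where "\<Delta> = row_depth (k + i) - row_depth k"
    define a where "a = snd v * l ^ \<Delta>"
    let ?J = "{a..<Suc (snd v) * l ^ \<Delta>}"
    let ?p = "low_pt (k + i) u"
    have pos: "0 < l ^ \<Delta>"
      using l by simp
    have end_eq: "Suc (snd v) * l ^ \<Delta> = Suc (a + (l ^ \<Delta> - 1))"
      using pos by (simp add: a_def)
    have child: "(u, j) \<in> children i k v" if "j \<in> ?J" for j
    proof -
      have "j div l ^ \<Delta> = snd v"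
        using that mem_block_iff[OF pos] unfolding a_def by blast
      then show ?thesis
        using u by (simp add: mem_children_iff \<Delta>_def)
    qed
    then have inJ: "(u, j) \<in> cells (k + i)" if "j \<in> ?J" for j
      using that children_subset_cells[OF v] by blast
    have near: "dist (?p j) (low_pt k (fst v) (snd v)) \<le> 3 / real m ^ k"
      "dist (?p j) (high_pt k (fst v) (snd v)) \<le> 3 / real m ^ k" if "j \<in> ?J" for j
    proof -
      note cells_j = inJ[OF that]
      obtain c b where cb: "coded c b" "cell (k + i) c b = (u, j)" "pt c b = ?p j"
        using obtain_code[OF cells_j] by auto
      have "cell k c b = v"
        using cell_in_children[OF cb(1), of k i] child[OF that] cb(2)
        by (simp add: mem_children_iff prod_eq_iff)
      then show "dist (?p j) (low_pt k (fst v) (snd v)) \<le> 3 / real m ^ k"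
        "dist (?p j) (high_pt k (fst v) (snd v)) \<le> 3 / real m ^ k"
        using dist_low_pt_cell[OF cb(1), of k v] dist_high_pt_cell[OF cb(1), of k v] cb(3)
        by (auto simp: dist_commute)
    qed
    have chain: "d (?p a) (?p (a + t)) \<le> (\<Sum>j\<in>{a..<a + t}. d (?p j) (?p (Suc j)))" for t
    proof (induction t)
      case 0
      show ?case
        using D_self[OF low_high_in_carpet(1)] by simp
    next
      case (Suc t)
      then show ?case
        using D_triangle[of "?p a" "?p (a + t)" "?p (Suc (a + t))"] low_high_in_carpet by simp
    qed
    have step: "d (?p j) (?p (Suc j)) \<le> C' * osc (k + i) (u, j)" if "j \<in> {a..<a + (l ^ \<Delta> - 1)}" for j
    proof -
      have j: "j \<in> ?J" "Suc j \<in> ?J"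
        using that unfolding end_eq by auto
      have divs: "j div l ^ \<Delta> = snd v" "Suc j div l ^ \<Delta> = snd v"
        using j mem_block_iff[OF pos] unfolding a_def by blast+
      have "dist (?p j) (?p (Suc j)) \<le> 3 / real m ^ (k + i)"
        using inJ[OF j(1)] inJ[OF j(2)] ki divs
        by (intro dist_low_Suc) (auto simp: cells_def \<Delta>_def)
      then show ?thesis
        unfolding osc_def fst_conv snd_conv using l m dist_low_high_cell[OF inJ[OF j(1)]]
        by (intro C'(2)[where \<rho> = "1 / real l ^ 2 * (1 / real m ^ (k + i))"] low_high_in_carpet) auto
    qed
    have "osc k v \<le> C * d (?p a) (?p (a + (l ^ \<Delta> - 1)))"
      unfolding osc_def
    proof (rule C(2)[where \<rho> = "1 / (2 * real l) * (1 / real m ^ k)"])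
      show "1 / (2 * real l) * (1 / real m ^ k) \<le> dist (?p a) (?p (a + (l ^ \<Delta> - 1)))"
        unfolding a_def \<Delta>_def using i v by (intro dist_low_ends) (auto simp: cells_def)
      have "a \<in> ?J"
        unfolding end_eq by simp
      then show "dist (?p a) (low_pt k (fst v) (snd v)) \<le> 6 * real l * (1 / (2 * real l) * (1 / real m ^ k))"
        "dist (?p a) (high_pt k (fst v) (snd v)) \<le> 6 * real l * (1 / (2 * real l) * (1 / real m ^ k))"
        using near[of a] l by auto
    qed (use l m low_high_in_carpet in auto)
    also have "\<dots> \<le> C * (\<Sum>j\<in>{a..<a + (l ^ \<Delta> - 1)}. d (?p j) (?p (Suc j)))"
      using chain C(1) by (intro mult_left_mono) auto
    also have "\<dots> \<le> C * (\<Sum>j\<in>{a..<a + (l ^ \<Delta> - 1)}. C' * osc (k + i) (u, j))"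
      using step C(1) by (intro mult_left_mono sum_mono) auto
    also have "\<dots> \<le> C * (\<Sum>j\<in>?J. C' * osc (k + i) (u, j))"
      using C(1) C'(1) inJ osc_pos unfolding end_eq
      by (intro mult_left_mono sum_mono2) (auto simp: less_imp_le)
    also have "\<dots> = C * C' * (\<Sum>j\<in>?J. osc (k + i) (u, j))"
      by (simp add: sum_distrib_left mult.assoc)
    finally show "1 / (C * C') * osc k v \<le>
       (\<Sum>j\<in>{snd v * l ^ (row_depth (k + i) - row_depth k)..<Suc (snd v) * l ^ (row_depth (k + i) - row_depth k)}.
          osc (k + i) (u, j))"
      using C(1) C'(1) unfolding a_def \<Delta>_def by (simp add: field_simps del: mult_Suc)
  qed
qed

lemma osc_decay:
  assumes "0 < \<epsilon>"
  obtains I where "\<And>i k c b. I \<le> i \<Longrightarrow> coded c b \<Longrightarrow>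
    osc (k + i) (cell (k + i) c b) \<le> \<epsilon> * osc k (cell k c b)"
proof -
  obtain \<delta> where \<delta>: "0 < \<delta>"
    "\<And>\<rho> x y u v. \<lbrakk>x \<in> carpet m l D; y \<in> carpet m l D; u \<in> carpet m l D; v \<in> carpet m l D; 0 < \<rho>;
       \<rho> \<le> dist u v; dist u x \<le> 6 * real l ^ 2 * \<rho>; dist x y \<le> \<delta> * \<rho>\<rbrakk> \<Longrightarrow> d x y \<le> \<epsilon> * d u v"
    using comparable_small[OF assms, of "6 * real l ^ 2"] by metis
  have "1 / real m < 1"
    using m by simp
  moreover have "0 < \<delta> / (6 * real l ^ 2)"
    using \<delta>(1) l by simp
  ultimately obtain I where I: "(1 / real m) ^ I < \<delta> / (6 * real l ^ 2)"
    using real_arch_pow_inv[of "\<delta> / (6 * real l ^ 2)" "1 / real m"] by blast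
  show ?thesis
  proof (rule that)
    fix i k c b
    assume i: "I \<le> i" and cb: "coded c b"
    let ?v = "cell k c b" and ?w = "cell (k + i) c b"
    have "(1 / real m) ^ i \<le> (1 / real m) ^ I"
      using i m by (intro power_decreasing) auto
    then have "6 * (1 / real m) ^ i \<le> 6 * (\<delta> / (6 * real l ^ 2))"
      using I by linarith
    then have "6 * (1 / real m) ^ i \<le> \<delta> / real l ^ 2"
      by simp
    then have "6 * (1 / real m) ^ i * (1 / real m ^ k) \<le> \<delta> / real l ^ 2 * (1 / real m ^ k)"
      by (intro mult_right_mono) auto
    then have small: "6 / real m ^ (k + i) \<le> \<delta> * (1 / real l ^ 2 * (1 / real m ^ k))"
      by (simp add: power_add power_one_over mult.commute)
    have "3 / real m ^ (k + i) \<le> 3 / real m ^ k"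
      using m by (intro divide_left_mono) (auto intro: power_increasing)
    then have "dist (low_pt k (fst ?v) (snd ?v)) (low_pt (k + i) (fst ?w) (snd ?w)) \<le> 6 / real m ^ k"
      using dist_low_pt_cell[OF cb refl, of k] dist_low_pt_cell[OF cb refl, of "k + i"]
        dist_triangle2[of "low_pt k (fst ?v) (snd ?v)" "low_pt (k + i) (fst ?w) (snd ?w)" "pt c b"]
      by simp
    moreover have "dist (low_pt (k + i) (fst ?w) (snd ?w)) (high_pt (k + i) (fst ?w) (snd ?w)) \<le> 6 / real m ^ (k + i)"
      using dist_high_pt_cell[OF cb refl, of "k + i"] dist_low_pt_cell[OF cb refl, of "k + i"]
        dist_triangle2[of "low_pt (k + i) (fst ?w) (snd ?w)" "high_pt (k + i) (fst ?w) (snd ?w)" "pt c b"]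
      by simp
    ultimately show "osc (k + i) ?w \<le> \<epsilon> * osc k ?v"
      unfolding osc_def using small l m dist_low_high_cell[OF cell_mem_cells[OF cb], of k]
      by (intro \<delta>(2)[where \<rho> = "1 / real l ^ 2 * (1 / real m ^ k)"] low_high_in_carpet) auto
  qed
qed


text \<open>The central estimate. With exponent \<^term>\<open>carpet_dim\<close>, adding the power mean bounds of the \<open>N ^ i\<close>
  columns loses a constant factor \<open>\<kappa>\<close> that does not depend on \<open>i\<close>. With a smaller exponent, the
  decay of the \<open>d\<close>-sizes gains a factor that exceeds \<open>1 / \<kappa>\<close> for large \<open>i\<close>.\<close>

lemma sum_children_ge:
  assumes s: "0 < s" "s < carpet_dim"
  obtains I where "0 < I" "\<And>i k v. \<lbrakk>I \<le> i; k + i \<le> row_depth k; v \<in> cells k\<rbrakk> \<Longrightarrow>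
      osc k v powr s \<le> (\<Sum>w\<in>children i k v. osc (k + i) w powr s)"
proof -
  obtain \<gamma> where \<gamma>: "0 < \<gamma>" "\<And>k i v u. \<lbrakk>0 < i; k + i \<le> row_depth k; v \<in> cells k; u div N ^ i = fst v\<rbrakk> \<Longrightarrow>
       \<gamma> * osc k v \<le>
       (\<Sum>j\<in>{snd v * l ^ (row_depth (k + i) - row_depth k)..<Suc (snd v) * l ^ (row_depth (k + i) - row_depth k)}.
          osc (k + i) (u, j))"
    using column_sum_ge by blast
  define \<kappa> where "\<kappa> = \<gamma> / 2 * (\<gamma> / (2 * real l)) powr (carpet_dim - 1)"
  have \<kappa>: "0 < \<kappa>"
    using \<gamma>(1) l by (simp add: \<kappa>_def)
  \<comment> \<open>The decay rate for which the gain exactly compensates the loss \<open>\<kappa>\<close>.\<close>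
  define \<epsilon> where "\<epsilon> = \<kappa> powr (1 / (carpet_dim - s))"
  have \<epsilon>: "0 < \<epsilon>" "\<epsilon> powr (s - carpet_dim) = 1 / \<kappa>"
  proof -
    have "1 / (carpet_dim - s) * (s - carpet_dim) = - 1"
      using s by (simp add: field_simps)
    then show "\<epsilon> powr (s - carpet_dim) = 1 / \<kappa>"
      using \<kappa> by (simp add: \<epsilon>_def powr_powr powr_minus_divide)
  qed (use \<kappa> in \<open>simp add: \<epsilon>_def\<close>)
  obtain I where I: "\<And>i k c b. I \<le> i \<Longrightarrow> coded c b \<Longrightarrow>
    osc (k + i) (cell (k + i) c b) \<le> \<epsilon> * osc k (cell k c b)"
    using osc_decay[OF \<epsilon>(1)] by blast
  show ?thesis
  proof (rule that[of "Suc I"])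
    fix i k v
    assume i: "Suc I \<le> i" and ki: "k + i \<le> row_depth k" and v: "v \<in> cells k"
    define \<Delta> where "\<Delta> = row_depth (k + i) - row_depth k"
    let ?U = "{fst v * N ^ i..<Suc (fst v) * N ^ i}" and ?J = "{snd v * l ^ \<Delta>..<Suc (snd v) * l ^ \<Delta>}"
    have children: "children i k v = ?U \<times> ?J"
      by (simp add: children_def \<Delta>_def)
    have pos: "0 < osc (k + i) w" if "w \<in> children i k v" for w
      using that children_subset_cells[OF v] osc_pos by blast
    have posv: "0 < osc k v"
      using v by (rule osc_pos)
    have card: "real (card ?J) \<le> real l * real m ^ i"
    proof -
      have "m ^ k * l ^ \<Delta> \<le> l ^ row_depth k * l ^ \<Delta>"
        using pow_le_row_depth by (rule mult_right_mono) simp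
      also have "\<dots> = l ^ row_depth (k + i)"
        using row_depth_mono[of k "k + i"] by (simp add: \<Delta>_def flip: power_add)
      also have "\<dots> \<le> m ^ k * (l * m ^ i)"
        using row_depth_pow_le[of "k + i"] by (simp add: power_add ac_simps)
      finally have "l ^ \<Delta> \<le> l * m ^ i"
        using m by simp
      then have "real (l ^ \<Delta>) \<le> real (l * m ^ i)"
        by (simp only: of_nat_le_iff)
      then show ?thesis
        by simp
    qed
    have column: "\<kappa> * osc k v powr carpet_dim / real N ^ i \<le> (\<Sum>j\<in>?J. osc (k + i) (u, j) powr carpet_dim)" if "u \<in> ?U" for u
    proof -
      have "u div N ^ i = fst v"
        using that N by (subst mem_block_iff[symmetric]) auto
      then have "\<gamma> * osc k v \<le> (\<Sum>j\<in>?J. osc (k + i) (u, j))"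
        unfolding \<Delta>_def using \<gamma>(2) i ki v by simp
      then have "\<gamma> * osc k v / 2 * (\<gamma> * osc k v / (2 * (real l * real m ^ i))) powr (carpet_dim - 1)
          \<le> (\<Sum>j\<in>?J. osc (k + i) (u, j) powr carpet_dim)"
        using card l m carpet_dim_ge_1 posv \<gamma>(1) by (intro sum_powr_ge) (auto simp: osc_def D_nonneg)
      moreover have "(\<gamma> * osc k v / (2 * (real l * real m ^ i))) powr (carpet_dim - 1) =
          (\<gamma> / (2 * real l)) powr (carpet_dim - 1) * osc k v powr (carpet_dim - 1) / real N ^ i"
      proof -
        have "\<gamma> * osc k v / (2 * (real l * real m ^ i)) = \<gamma> / (2 * real l) * osc k v / real m ^ i"
          by simp
        then show ?thesis
          using powr_carpet_dim[of i] posv \<gamma>(1) by (simp only: powr_divide powr_mult)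
      qed
      moreover have "osc k v powr carpet_dim = osc k v * osc k v powr (carpet_dim - 1)"
        using posv powr_mult_base[of "osc k v" "carpet_dim - 1"] by simp
      ultimately show ?thesis
        by (simp add: \<kappa>_def mult_ac)
    qed
    have "\<kappa> * osc k v powr carpet_dim = (\<Sum>u\<in>?U. \<kappa> * osc k v powr carpet_dim / real N ^ i)"
      using N by simp
    also have "\<dots> \<le> (\<Sum>u\<in>?U. \<Sum>j\<in>?J. osc (k + i) (u, j) powr carpet_dim)"
      by (intro sum_mono column)
    also have "\<dots> = (\<Sum>w\<in>children i k v. osc (k + i) w powr carpet_dim)"
      unfolding children by (simp add: sum.cartesian_product)
    finally have sumQ: "\<kappa> * osc k v powr carpet_dim \<le> (\<Sum>w\<in>children i k v. osc (k + i) w powr carpet_dim)" .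
    have "osc k v powr s = osc k v powr (s - carpet_dim) * osc k v powr carpet_dim"
      by (simp flip: powr_add)
    also have "\<dots> = (\<epsilon> * osc k v) powr (s - carpet_dim) * (\<kappa> * osc k v powr carpet_dim)"
      using \<epsilon> \<kappa> posv by (simp add: powr_mult)
    also have "\<dots> \<le> (\<epsilon> * osc k v) powr (s - carpet_dim) * (\<Sum>w\<in>children i k v. osc (k + i) w powr carpet_dim)"
      using sumQ by (intro mult_left_mono) auto
    also have "\<dots> = (\<Sum>w\<in>children i k v. (\<epsilon> * osc k v) powr (s - carpet_dim) * osc (k + i) w powr carpet_dim)"
      by (rule sum_distrib_left)
    also have "\<dots> \<le> (\<Sum>w\<in>children i k v. osc (k + i) w powr s)"
    proof (rule sum_mono)
      fix w assume w: "w \<in> children i k v"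
      then have "w \<in> cells (k + i)"
        using children_subset_cells[OF v] by blast
      then obtain c b where cb: "coded c b" "cell (k + i) c b = w"
        using obtain_code by blast
      have "cell k c b = v"
        using cell_in_children[OF cb(1), of k i] w cb(2)
        by (simp add: mem_children_iff prod_eq_iff)
      then have "osc (k + i) w \<le> \<epsilon> * osc k v"
        using I[of i c b k] i cb by simp
      then have "(\<epsilon> * osc k v) powr (s - carpet_dim) \<le> osc (k + i) w powr (s - carpet_dim)"
        using s pos[OF w] by (intro powr_mono2') auto
      then have "(\<epsilon> * osc k v) powr (s - carpet_dim) * osc (k + i) w powr carpet_dim
          \<le> osc (k + i) w powr (s - carpet_dim) * osc (k + i) w powr carpet_dim"
        by (intro mult_right_mono) auto
      then show "(\<epsilon> * osc k v) powr (s - carpet_dim) * osc (k + i) w powr carpet_dim \<le> osc (k + i) w powr s"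
        by (simp flip: powr_add)
    qed
    finally show "osc k v powr s \<le> (\<Sum>w\<in>children i k v. osc (k + i) w powr s)" .
  qed simp
qed

end


section \<open>Covers of a quasisymmetric image\<close>

context uniform_carpet_qs
begin

text \<open>The part of a set \<open>U\<close> of \<open>d\<close>-diameter at most \<open>r\<close> that is coded in the cell \<open>v0\<close> is covered by
  boundedly many cells of \<open>d\<close>-size \<open>O(r)\<close>, all of one generation: the first at which the cell of one
  chosen point of that part has \<open>d\<close>-size at most \<open>r\<close>. The cell of this point one generation earlier has \<open>d\<close>-size greater than \<open>r\<close>, so the Euclidean diameter of the part is at most comparable with
  its side.\<close>

lemma cover_by_cells:
  assumes i: "0 < i"
    and decay: "\<And>k c b. coded c b \<Longrightarrow> osc (k + i) (cell (k + i) c b) \<le> 1 / 2 * osc k (cell k c b)"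
  obtains B C where "0 < B" "0 < C"
    "\<And>U r. \<lbrakk>0 < r; r < osc k0 v0; \<And>x y. x \<in> U \<inter> carpet m l D \<Longrightarrow> y \<in> U \<inter> carpet m l D \<Longrightarrow> d x y \<le> r\<rbrakk> \<Longrightarrow>
       \<exists>T. finite T \<and> real (card T) \<le> B \<and> (\<forall>(g, v)\<in>T. osc (k0 + g * i) v \<le> C * r) \<and>
         (\<forall>c b. coded c b \<longrightarrow> cell k0 c b = v0 \<longrightarrow> pt c b \<in> U \<longrightarrow> (\<exists>g. (g, cell (k0 + g * i) c b) \<in> T))"
proof -
  obtain C1 where C1: "0 < C1"
    "\<And>\<rho> x y u v. \<lbrakk>x \<in> carpet m l D; y \<in> carpet m l D; u \<in> carpet m l D; v \<in> carpet m l D; u \<noteq> v;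
       dist x u \<le> 3 * \<rho>; dist x v \<le> 3 * \<rho>; d x y \<le> d u v\<rbrakk> \<Longrightarrow> dist x y \<le> C1 * \<rho>"
    using comparable_inverse[of 3] by (metis zero_less_numeral)
  define R where "R = C1 * real m ^ i"
  have R: "0 < R"
    using C1(1) m by (simp add: R_def)
  obtain C where C: "0 < C"
    "\<And>\<rho> x y u v. \<lbrakk>x \<in> carpet m l D; y \<in> carpet m l D; u \<in> carpet m l D; v \<in> carpet m l D; 0 < \<rho>;
       \<rho> \<le> dist u v; dist u x \<le> (R + 6) * real l ^ 2 * \<rho>; dist u y \<le> (R + 6) * real l ^ 2 * \<rho>\<rbrakk> \<Longrightarrow> d x y \<le> C * d u v"
    using comparable[of "(R + 6) * real l ^ 2"] by metis
  define B where "B = (2 * (R + 1) + 1) * (2 * (R * real l + 1) + 1)"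
  have B: "0 < B"
    unfolding B_def using R by (intro mult_pos_pos add_nonneg_pos) auto
  show ?thesis
  proof (rule that[OF B C(1)])
    fix U :: "(real \<times> real) set" and r :: real
    assume r: "0 < r" "r < osc k0 v0"
      and U: "\<And>x y. x \<in> U \<inter> carpet m l D \<Longrightarrow> y \<in> U \<inter> carpet m l D \<Longrightarrow> d x y \<le> r"
    define A where "A = {(c, b). coded c b \<and> cell k0 c b = v0 \<and> pt c b \<in> U}"
    show "\<exists>T. finite T \<and> real (card T) \<le> B \<and> (\<forall>(g, v)\<in>T. osc (k0 + g * i) v \<le> C * r) \<and>
         (\<forall>c b. coded c b \<longrightarrow> cell k0 c b = v0 \<longrightarrow> pt c b \<in> U \<longrightarrow> (\<exists>g. (g, cell (k0 + g * i) c b) \<in> T))"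
    proof (cases "A = {}")
      case True
      then show ?thesis
        using B by (intro exI[of _ "{}"]) (auto simp: A_def)
    next
      case False
      then obtain c b where cb: "coded c b" "cell k0 c b = v0" "pt c b \<in> U"
        by (auto simp: A_def)
      define P where "P g \<longleftrightarrow> osc (k0 + g * i) (cell (k0 + g * i) c b) \<le> r" for g
      have "\<exists>g. P g"
      proof -
        have pow: "osc (k0 + g * i) (cell (k0 + g * i) c b) \<le> (1 / 2) ^ g * osc k0 v0" for g
        proof (induction g)
          case (Suc g)
          have "osc (k0 + Suc g * i) (cell (k0 + Suc g * i) c b)
              \<le> 1 / 2 * osc (k0 + g * i) (cell (k0 + g * i) c b)"
            using decay[OF cb(1), of "k0 + g * i"] by (simp add: ac_simps)
          then show ?case
            using Suc by simp
        qed (simp add: cb(2))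
        have pos: "0 < osc k0 v0"
          using r by linarith
        obtain g where g: "(1 / 2 :: real) ^ g < r / osc k0 v0"
          using real_arch_pow_inv[of "r / osc k0 v0" "1 / 2"] r pos by auto
        then have "(1 / 2) ^ g * osc k0 v0 \<le> r"
          using pos by (simp add: field_simps)
        then show ?thesis
          using pow[of g] unfolding P_def by (meson order_trans)
      qed
      then obtain g where g: "P g" "\<And>g'. g' < g \<Longrightarrow> \<not> P g'"
        by (meson LeastI_ex not_less_Least)
      have "g \<noteq> 0"
        using g(1) r(2) cb(2) by (intro notI) (simp add: P_def)
      then obtain g' where g': "g = Suc g'"
        using not0_implies_Suc by blast
      define k k' where "k = k0 + g * i" and "k' = k0 + g' * i"
      have kk': "k = k' + i"
        by (simp add: k_def k'_def g')
      let ?w = "cell k' c b" and ?v = "cell k c b"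
      have big: "r < osc k' ?w" and small: "osc k ?v \<le> r"
        using g(1) g(2)[of g'] by (auto simp: P_def k_def k'_def g')
      have near: "dist (pt c b) (pt c' b') \<le> R / real m ^ k" if "(c', b') \<in> A" for c' b'
      proof -
        have cb': "coded c' b'" "pt c' b' \<in> U"
          using that by (auto simp: A_def)
        have "dist (pt c b) (pt c' b') \<le> C1 * (1 / real m ^ k')"
        proof (rule C1(2))
          show "dist (pt c b) (low_pt k' (fst ?w) (snd ?w)) \<le> 3 * (1 / real m ^ k')"
            "dist (pt c b) (high_pt k' (fst ?w) (snd ?w)) \<le> 3 * (1 / real m ^ k')"
            using dist_low_pt_cell[OF cb(1) refl, of k'] dist_high_pt_cell[OF cb(1) refl, of k']
            by (simp_all add: dist_commute)
          have "d (pt c b) (pt c' b') \<le> r"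
            using U cb cb' pt_in_carpet by auto
          then show "d (pt c b) (pt c' b') \<le> d (low_pt k' (fst ?w) (snd ?w)) (high_pt k' (fst ?w) (snd ?w))"
            using big by (simp add: osc_def)
          show "low_pt k' (fst ?w) (snd ?w) \<noteq> high_pt k' (fst ?w) (snd ?w)"
            using big r(1) D_self[OF low_high_in_carpet(1)] D_self[OF low_high_in_carpet(2)] by (auto simp: osc_def)
        qed (use cb cb' pt_in_carpet low_high_in_carpet in auto)
        also have "\<dots> = R / real m ^ k"
          using m by (simp add: R_def kk' power_add)
        finally show ?thesis .
      qed
      have small': "osc k (cell k c' b') \<le> C * r" if "(c', b') \<in> A" for c' b'
      proof -
        let ?v' = "cell k c' b'"
        have cb': "coded c' b'"
          using that by (auto simp: A_def)
        note low = dist_low_pt_cell[OF cb(1) refl, of k]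
        have lr: "(R + 6) * real l ^ 2 * (1 / real l ^ 2 * (1 / real m ^ k)) = R / real m ^ k + 6 / real m ^ k"
          using l by (simp add: add_divide_distrib)
        have "osc k ?v' \<le> C * osc k ?v"
          unfolding osc_def
        proof (rule C(2)[where \<rho> = "1 / real l ^ 2 * (1 / real m ^ k)"])
          let ?x = "low_pt k (fst ?v) (snd ?v)"
          have *: "dist ?x y \<le> R / real m ^ k + 6 / real m ^ k"
            if "dist y (pt c' b') \<le> 3 / real m ^ k" for y
          proof -
            have "dist ?x y \<le> dist ?x (pt c b) + dist (pt c b) (pt c' b') + dist y (pt c' b')"
              using dist_triangle[of ?x y "pt c b"] dist_triangle2[of "pt c b" y "pt c' b'"] by linarith
            also have "\<dots> \<le> 3 / real m ^ k + R / real m ^ k + 3 / real m ^ k"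
              using low near[OF \<open>(c', b') \<in> A\<close>] that by linarith
            finally show ?thesis by simp
          qed
          show "dist ?x (low_pt k (fst ?v') (snd ?v')) \<le> (R + 6) * real l ^ 2 * (1 / real l ^ 2 * (1 / real m ^ k))"
            unfolding lr by (intro * dist_low_pt_cell[OF cb' refl])
          show "dist ?x (high_pt k (fst ?v') (snd ?v')) \<le> (R + 6) * real l ^ 2 * (1 / real l ^ 2 * (1 / real m ^ k))"
            unfolding lr by (intro * dist_high_pt_cell[OF cb' refl])
          show "1 / real l ^ 2 * (1 / real m ^ k) \<le> dist ?x (high_pt k (fst ?v) (snd ?v))"
            by (rule dist_low_high_cell[OF cell_mem_cells[OF cb(1)]])
        qed (use l m low_high_in_carpet in auto)
        also have "\<dots> \<le> C * r"
          using small C(1) by (intro mult_left_mono) auto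
        finally show ?thesis .
      qed
      define F where "F = (\<lambda>(c, b). cell k c b) ` A"
      have fin: "finite F" and card: "real (card F) \<le> B"
        unfolding F_def B_def using near R
        by (intro cells_near_point[where z = "pt c b"]; force simp: A_def)+
      have "card (Pair g ` F) = card F"
        by (intro card_image) (auto simp: inj_on_def)
      then show ?thesis
        using fin card small'
        by (intro exI[of _ "Pair g ` F"]) (auto simp: F_def k_def A_def)
    qed
  qed
qed

text \<open>Every cover of the carpet by sets of \<open>d\<close>-diameter at most \<open>r n\<close> has \<open>\<Sum>n. (r n) powr s\<close> bounded from
  below. Otherwise the cells that replace the sets of the cover would be too light for the tree of
  cells, weighted by \<open>d\<close>-size to the power \<open>s\<close>; a branch avoiding them codes a point that is not covered.\<close>

lemma covers_have_large_sum:
  assumes s: "0 < s" "s < carpet_dim"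
  obtains c where "0 < c"
    "\<And>U r. \<lbrakk>\<And>n. 0 < r n; \<And>n x y. x \<in> U n \<inter> carpet m l D \<Longrightarrow> y \<in> U n \<inter> carpet m l D \<Longrightarrow> d x y \<le> r n;
       carpet m l D \<subseteq> (\<Union>n::nat. U n)\<rbrakk> \<Longrightarrow> ennreal c \<le> (\<Sum>n. ennreal (r n powr s))"
proof -
  obtain I1 where I1: "0 < I1" "\<And>i k v. \<lbrakk>I1 \<le> i; k + i \<le> row_depth k; v \<in> cells k\<rbrakk> \<Longrightarrow>
      osc k v powr s \<le> (\<Sum>w\<in>children i k v. osc (k + i) w powr s)"
    using sum_children_ge[OF s] by metis
  obtain I2 where I2: "\<And>i k c b. I2 \<le> i \<Longrightarrow> coded c b \<Longrightarrow>
      osc (k + i) (cell (k + i) c b) \<le> 1 / 2 * osc k (cell k c b)"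
    using osc_decay[of "1 / 2"] by (metis half_gt_zero_iff zero_less_one)
  define i where "i = max I1 I2"
  have i: "0 < i" "I1 \<le> i" "I2 \<le> i"
    using I1(1) by (auto simp: i_def)
  \<comment> \<open>The estimate for children holds only from a generation \<open>k0\<close> on, where the tree is rooted.\<close>
  obtain k0 where k0: "\<And>k. k0 \<le> k \<Longrightarrow> k + i \<le> row_depth k"
    using eventually_row_depth_ge[of i] by blast
  define K where "K g = k0 + g * i" for g
  have K_Suc: "K (Suc g) = K g + i" for g
    by (simp add: K_def)
  have K_mono: "K g \<le> K g'" if "g \<le> g'" for g g'
    using that by (simp add: K_def)
  have K_ge: "g \<le> K g" for g
    using i(1) by (simp add: K_def trans_le_add2)
  define v0 :: "nat \<times> nat" where "v0 = (0, 0)"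
  have v0: "v0 \<in> cells k0"
    using N l by (simp add: cells_def v0_def)
  have R0: "0 < osc k0 v0"
    using v0 by (rule osc_pos)
  obtain B C where B: "0 < B" and C: "0 < C" and BC:
    "\<And>U r. \<lbrakk>0 < r; r < osc k0 v0; \<And>x y. x \<in> U \<inter> carpet m l D \<Longrightarrow> y \<in> U \<inter> carpet m l D \<Longrightarrow> d x y \<le> r\<rbrakk> \<Longrightarrow>
       \<exists>T. finite T \<and> real (card T) \<le> B \<and> (\<forall>(g, v)\<in>T. osc (k0 + g * i) v \<le> C * r) \<and>
         (\<forall>c b. coded c b \<longrightarrow> cell k0 c b = v0 \<longrightarrow> pt c b \<in> U \<longrightarrow> (\<exists>g. (g, cell (k0 + g * i) c b) \<in> T))"
    using cover_by_cells[OF i(1) I2[OF i(3)], of k0 v0] by metis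
  define L where "L = B * C powr s"
  have L: "0 < L"
    using B C by (simp add: L_def)
  define c0 where "c0 = min (osc k0 v0 powr s) (osc k0 v0 powr s / L)"
  show ?thesis
  proof (rule that[of c0])
    show "0 < c0"
      using R0 L by (simp add: c0_def)
  next
    fix U :: "nat \<Rightarrow> (real \<times> real) set" and r :: "nat \<Rightarrow> real"
    assume r: "\<And>n. 0 < r n"
      and U: "\<And>n x y. x \<in> U n \<inter> carpet m l D \<Longrightarrow> y \<in> U n \<inter> carpet m l D \<Longrightarrow> d x y \<le> r n"
      and cover: "carpet m l D \<subseteq> (\<Union>n. U n)"
    show "ennreal c0 \<le> (\<Sum>n. ennreal (r n powr s))"
    proof (rule ccontr)
      assume "\<not> ?thesis"
      then have less: "(\<Sum>n. ennreal (r n powr s)) < ennreal c0"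
        by (simp add: not_le)
      have r_less: "r n < osc k0 v0" for n
      proof -
        have "(\<Sum>k\<in>{n}. ennreal (r k powr s)) \<le> (\<Sum>k. ennreal (r k powr s))"
          by (rule sum_le_suminf) auto
        also note less
        finally have "ennreal (r n powr s) < ennreal c0"
          by simp
        then have "r n powr s < osc k0 v0 powr s"
          by (simp add: ennreal_less_iff c0_def)
        then show ?thesis
          using powr_mono2[of s "osc k0 v0" "r n"] R0 s by (meson leD less_imp_le not_le)
      qed
      have "\<exists>T. \<forall>n. finite (T n) \<and> real (card (T n)) \<le> B \<and> (\<forall>(g, v)\<in>T n. osc (k0 + g * i) v \<le> C * r n) \<and>
         (\<forall>c b. coded c b \<longrightarrow> cell k0 c b = v0 \<longrightarrow> pt c b \<in> U n \<longrightarrow> (\<exists>g. (g, cell (k0 + g * i) c b) \<in> T n))"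
        using BC[OF r r_less U] by (intro choice allI) blast
      then obtain T where fin: "\<And>n. finite (T n)" and card: "\<And>n. real (card (T n)) \<le> B"
        and T_small: "\<And>n g v. (g, v) \<in> T n \<Longrightarrow> osc (K g) v \<le> C * r n"
        and T_cover: "\<And>n c b. coded c b \<Longrightarrow> cell k0 c b = v0 \<Longrightarrow> pt c b \<in> U n \<Longrightarrow>
          \<exists>g. (g, cell (K g) c b) \<in> T n"
        unfolding K_def by blast
      define w :: "nat \<times> nat \<times> nat \<Rightarrow> ennreal" where "w = (\<lambda>(g, v). ennreal (osc (K g) v powr s))"
      let ?\<mu> = "point_measure UNIV w"
      have "emeasure ?\<mu> (\<Union>n. T n) \<le> (\<Sum>n. emeasure ?\<mu> (T n))"
        by (rule emeasure_subadditive_countably) (auto simp: sets_point_measure)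
      also have "\<dots> \<le> (\<Sum>n. ennreal L * ennreal (r n powr s))"
      proof (rule suminf_le)
        fix n
        have "w p \<le> ennreal ((C * r n) powr s)" if "p \<in> T n" for p
        proof -
          obtain g v where p: "p = (g, v)"
            by (cases p)
          have "osc (K g) v powr s \<le> (C * r n) powr s"
            using T_small[of g v n] that s p by (intro powr_mono2) (auto simp: osc_def D_nonneg)
          then show ?thesis
            by (simp add: w_def p ennreal_leI)
        qed
        then have "(\<Sum>p\<in>T n. w p) \<le> of_nat (card (T n)) * ennreal ((C * r n) powr s)"
          by (rule sum_bounded_above)
        also have "\<dots> = ennreal (real (card (T n)) * (C * r n) powr s)"
          by (simp add: ennreal_mult ennreal_of_nat_eq_real_of_nat)
        also have "\<dots> \<le> ennreal (B * (C * r n) powr s)"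
          using card by (intro ennreal_leI mult_right_mono) auto
        also have "\<dots> = ennreal L * ennreal (r n powr s)"
          using C B r[of n] by (simp add: L_def powr_mult ennreal_mult[symmetric] mult.assoc)
        finally show "emeasure ?\<mu> (T n) \<le> ennreal L * ennreal (r n powr s)"
          using fin by (simp add: emeasure_point_measure_finite2)
      qed auto
      also have "\<dots> = ennreal L * (\<Sum>n. ennreal (r n powr s))"
        by (rule ennreal_suminf_cmult)
      also have "\<dots> < ennreal L * ennreal (osc k0 v0 powr s / L)"
      proof (rule ennreal_mult_strict_left_mono)
        show "(\<Sum>n. ennreal (r n powr s)) < ennreal (osc k0 v0 powr s / L)"
          using less by (rule less_le_trans) (simp add: c0_def ennreal_leI)
      qed (use L in auto)
      also have "\<dots> = w (0, v0)"
        using L R0 by (simp add: w_def K_def ennreal_mult[symmetric])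
      finally have light: "emeasure ?\<mu> (\<Union>n. T n) < w (0, v0)" .
      \<comment> \<open>The tree of cells of generations \<open>k0 + g * i\<close>, rooted in \<open>v0\<close>.\<close>
      define V where "V = {(g, v). v \<in> cells (K g)}"
      define child where "child = (\<lambda>(g, v). Pair (Suc g) ` children i (K g) v)"
      define below where "below = (\<lambda>(g, v). {(g', v'). g \<le> g' \<and>
          fst v' div N ^ (K g' - K g) = fst v \<and>
          snd v' div l ^ (row_depth (K g') - row_depth (K g)) = snd v})"
      obtain \<xi> where \<xi>: "\<xi> 0 = (0, v0)" "\<And>g. \<xi> (Suc g) \<in> child (\<xi> g)" "\<And>g. \<xi> g \<in> V - (\<Union>n. T n)"
      proof (rule branch_avoiding[where w = w and V = V and child = child and below = below
            and T = "\<Union>n. T n" and ?v0.0 = "(0, v0)"])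
        show "(0, v0) \<in> V"
          using v0 by (simp add: V_def K_def)
        show "finite (child p) \<and> child p \<subseteq> V" if "p \<in> V" for p
          using that children_subset_cells[of "snd p" "K (fst p)" i]
          by (auto simp: child_def V_def finite_children K_Suc)
        show "w p \<le> (\<Sum>q\<in>child p. w q)" if p: "p \<in> V" for p
        proof -
          obtain g v where gv: "p = (g, v)"
            by (cases p)
          have "osc (K g) v powr s \<le> (\<Sum>v'\<in>children i (K g) v. osc (K g + i) v' powr s)"
            using p gv i(2) k0[of "K g"] by (intro I1(2)) (auto simp: V_def K_def)
          then have "w p \<le> (\<Sum>v'\<in>children i (K g) v. ennreal (osc (K g + i) v' powr s))"
            by (simp add: w_def gv ennreal_leI sum_ennreal)
          also have "\<dots> = (\<Sum>q\<in>child p. w q)"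
            by (simp add: child_def gv w_def K_Suc sum.reindex inj_on_def)
          finally show ?thesis .
        qed
        show "below q \<subseteq> below p" if q: "q \<in> child p" for p q
        proof -
          obtain g v v1 where gv: "p = (g, v)" "q = (Suc g, v1)" "v1 \<in> children i (K g) v"
            using q by (cases p) (auto simp: child_def)
          show ?thesis
          proof
            fix p' assume "p' \<in> below q"
            then obtain g' v' where p': "p' = (g', v')" "Suc g \<le> g'"
              "fst v' div N ^ (K g' - K (Suc g)) = fst v1"
              "snd v' div l ^ (row_depth (K g') - row_depth (K (Suc g))) = snd v1"
              by (auto simp: below_def gv)
            have "K g' - K g = (K g' - K (Suc g)) + i"
              using K_mono[OF p'(2)] by (simp add: K_Suc)
            moreover have "row_depth (K g') - row_depth (K g) = (row_depth (K g') - row_depth (K (Suc g))) +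
                (row_depth (K g + i) - row_depth (K g))"
              using row_depth_mono[OF K_mono[OF p'(2)]] row_depth_mono[of "K g" "K g + i"] by (simp add: K_Suc)
            ultimately show "p' \<in> below p"
              using p' gv(3) by (simp add: below_def gv(1) mem_children_iff power_add div_mult2_eq)
          qed
        qed
        show "disjoint_family_on below (child p)" for p
          unfolding disjoint_family_on_def
        proof (intro ballI impI)
          fix q q' assume "q \<in> child p" "q' \<in> child p" "q \<noteq> q'"
          then show "below q \<inter> below q' = {}"
            by (cases p) (auto simp: child_def below_def prod_eq_iff)
        qed
        show "p \<in> below p" for p
          by (cases p) (simp add: below_def)
        show "emeasure ?\<mu> (\<Union>n. T n) < w (0, v0)"
          by (rule light)
      qed blast
      have fst_\<xi>: "fst (\<xi> g) = g" for g
      proof (induction g)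
        case (Suc g)
        then show ?case
          using \<xi>(2)[of g] by (cases "\<xi> g") (auto simp: child_def)
      qed (simp add: \<xi>(1))
      define v where "v g = snd (\<xi> g)" for g
      have \<xi>_eq: "\<xi> g = (g, v g)" for g
        using fst_\<xi>[of g] by (simp add: v_def prod_eq_iff)
      have v_Suc: "v (Suc g) \<in> children i (K g) (v g)" for g
        using \<xi>(2)[of g] by (auto simp: child_def \<xi>_eq)
      have v_0: "v 0 = v0"
        by (simp add: v_def \<xi>(1))
      have "\<exists>c. (\<forall>t. c t < N) \<and> (\<forall>g. radix N c (K g) = fst (v g))"
        using N K_ge v_Suc v_0 by (intro radix_limit) (auto simp: K_Suc mem_children_iff v0_def)
      then obtain c where c: "\<And>t. c t < N" "\<And>g. radix N c (K g) = fst (v g)"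
        by blast
      have "\<exists>b. (\<forall>t. b t < l) \<and> (\<forall>g. radix l b (row_depth (K g)) = snd (v g))"
        using l K_ge le_row_depth v_Suc v_0
        by (intro radix_limit) (auto simp: K_Suc mem_children_iff v0_def intro: row_depth_mono order_trans)
      then obtain b where b: "\<And>t. b t < l" "\<And>g. radix l b (row_depth (K g)) = snd (v g)"
        by blast
      have coded: "coded c b"
        using c(1) b(1) by (simp add: coded_def)
      have cell: "cell (K g) c b = v g" for g
        using c(2) b(2) by (simp add: cell_def)
      then have "cell k0 c b = v0"
        using v_0 by (metis K_def add.right_neutral mult_zero_left)
      moreover obtain n where "pt c b \<in> U n"
        using pt_in_carpet[OF coded] cover by blast
      ultimately obtain g where "(g, cell (K g) c b) \<in> T n"
        using T_cover[OF coded] by blast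
      then show False
        using \<xi>(3)[of g] by (auto simp: cell \<xi>_eq)
    qed
  qed
qed

end


section \<open>Hausdorff dimension and minimality\<close>

context uniform_carpet
begin

lemma hausdorff_dim_quasisymmetric_image_ge:
  assumes qs: "quasisymmetric (submetric euclidean_metric (carpet m l D)) Y f"
  shows "ennreal carpet_dim \<le> hausdorff_dim Y"
  unfolding hausdorff_dim_def
proof (rule INF_greatest)
  fix s :: real
  assume "s \<in> {s. 0 < s \<and> hausdorff_measure Y s = 0}"
  then have s: "0 < s" "hausdorff_measure Y s = 0"
    by auto
  show "ennreal carpet_dim \<le> ennreal s"
  proof (rule ccontr)
    assume "\<not> ?thesis"
    then have less: "s < carpet_dim"
      by (meson ennreal_leI not_le)
    interpret qs_distance "carpet m l D" "\<lambda>x y. mdist Y (f x) (f y)"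
      using qs by (rule qs_distance_of_quasisymmetric)
    interpret uniform_carpet_qs m l N D col "\<lambda>x y. mdist Y (f x) (f y)" ..
    obtain c where c: "0 < c" "\<And>U r. \<lbrakk>\<And>n. 0 < r n;
        \<And>n x y. x \<in> U n \<inter> carpet m l D \<Longrightarrow> y \<in> U n \<inter> carpet m l D \<Longrightarrow> mdist Y (f x) (f y) \<le> r n;
        carpet m l D \<subseteq> (\<Union>n::nat. U n)\<rbrakk> \<Longrightarrow> ennreal c \<le> (\<Sum>n. ennreal (r n powr s))"
      using covers_have_large_sum[OF s(1) less] by metis
    \<comment> \<open>The bound 1 on the diameters of the cover serves only to make them finite.\<close>
    have "ennreal (c / 2) \<le> hausdorff_premeasure Y s 1"
      unfolding hausdorff_premeasure_def
    proof (rule INF_greatest)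
      fix U :: "nat \<Rightarrow> 'a set"
      assume U: "U \<in> {U. (\<forall>i. U i \<subseteq> mspace Y \<and> ediam Y (U i) \<le> ennreal 1) \<and> mspace Y \<subseteq> (\<Union>i. U i)}"
      define diam where "diam n = enn2real (ediam Y (U n))" for n
      \<comment> \<open>Slightly more than the diameters, as sets of diameter 0 need a positive radius as well.\<close>
      define r where "r n = (diam n powr s + c / 2 * (1 / 2) ^ Suc n) powr (1 / s)" for n
      have pos: "0 < c / 2 * (1 / 2) ^ Suc n" for n
        using c(1) by simp
      have r_powr: "r n powr s = diam n powr s + c / 2 * (1 / 2) ^ Suc n" for n
        using add_nonneg_pos[OF powr_ge_zero pos, of "diam n" s n] s(1)
        unfolding r_def powr_powr by simp
      have "ennreal c \<le> (\<Sum>n. ennreal (r n powr s))"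
      proof (rule c(2)[where U = "\<lambda>n. f -` U n"])
        show "0 < r n" for n
          using add_nonneg_pos[OF powr_ge_zero pos, of "diam n" s n] unfolding r_def by simp
        show "carpet m l D \<subseteq> (\<Union>n. f -` U n)"
          using U qs_distance_of_quasisymmetric(2)[OF qs] by fastforce
        fix n x y
        assume xy: "x \<in> f -` U n \<inter> carpet m l D" "y \<in> f -` U n \<inter> carpet m l D"
        have "ennreal (mdist Y (f x) (f y)) \<le> ediam Y (U n)"
          unfolding ediam_def using xy by (intro SUP_upper2[of "(f x, f y)"]) auto
        moreover have "ediam Y (U n) < top"
          using U by (auto intro: le_less_trans[of _ "ennreal 1"])
        ultimately have "mdist Y (f x) (f y) \<le> diam n"
          unfolding diam_def by (metis enn2real_mono enn2real_ennreal mdist_nonneg)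
        also have "\<dots> = (diam n powr s) powr (1 / s)"
          using s(1) by (simp add: powr_powr diam_def)
        also have "\<dots> \<le> r n"
          unfolding r_def using s(1) pos[of n] by (intro powr_mono2) auto
        finally show "mdist Y (f x) (f y) \<le> r n" .
      qed
      also have "\<dots> = (\<Sum>n. ennreal (c / 2 * (1 / 2) ^ Suc n) + ennreal (diam n powr s))"
        unfolding r_powr using pos
        by (subst add.commute, intro suminf_cong ennreal_plus) (auto intro: less_imp_le)
      also have "\<dots> = (\<Sum>n. ennreal (c / 2 * (1 / 2) ^ Suc n)) + (\<Sum>n. ennreal (diam n powr s))"
        by (rule suminf_add[symmetric]) auto
      also have "(\<Sum>n. ennreal (c / 2 * (1 / 2) ^ Suc n)) = ennreal (c / 2)"
      proof -
        have "(\<lambda>n. c / 2 * (1 / 2) ^ Suc n) sums (c / 2 * 1)"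
          by (intro sums_mult power_half_series)
        then show ?thesis
          using pos by (simp only: suminf_ennreal_eq mult_1_right less_imp_le)
      qed
      finally have "ennreal (c / 2) + ennreal (c / 2) \<le> ennreal (c / 2) + (\<Sum>n. ennreal (diam n powr s))"
        using c(1) by (simp flip: ennreal_plus)
      then show "ennreal (c / 2) \<le> (\<Sum>i. ennreal (enn2real (ediam Y (U i)) powr s))"
        unfolding diam_def ennreal_add_left_cancel_le by simp
    qed
    also have "\<dots> \<le> hausdorff_measure Y s"
      unfolding hausdorff_measure_def by (rule SUP_upper) simp
    finally show False
      using c(1) s(2) by simp
  qed
qed

lemma hausdorff_measure_carpet_eq_0:
  assumes s: "carpet_dim < s"
  shows "hausdorff_measure (submetric euclidean_metric (carpet m l D)) s = 0"
proof -
  let ?X = "submetric euclidean_metric (carpet m l D)"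
  \<comment> \<open>The cover by the boxes of generation \<open>k\<close> has a sum of order \<open>q ^ k\<close>.\<close>
  define q where "q = real N * real m / real m powr s"
  have "real m powr carpet_dim = real N * real m"
    using m N by (simp add: carpet_dim_def powr_add)
  moreover have "real m powr carpet_dim < real m powr s"
    using s m by (intro powr_less_mono) auto
  ultimately have q: "0 \<le> q" "q < 1"
    using m by (simp_all add: q_def divide_less_eq)
  have s0: "0 < s"
    using s carpet_dim_ge_1 by simp
  have bound: "hausdorff_premeasure ?X s \<delta> \<le> ennreal (2 powr s * real l * q ^ k)"
    if k: "0 < k" "2 / real m ^ k \<le> \<delta>" for k \<delta>
  proof -
    define H where "H = l ^ row_depth k"
    define n where "n = N ^ k * H"
    define U where "U i = (if i < n then box k (i div H) (i mod H) \<inter> carpet m l D else {})" for i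
    have H: "0 < H"
      using l by (simp add: H_def)
    have ediam: "ediam ?X (U i) \<le> ennreal (2 / real m ^ k)" for i
      unfolding ediam_def
    proof (rule SUP_least)
      fix p assume "p \<in> U i \<times> U i"
      then show "(case p of (x, y) \<Rightarrow> ennreal (mdist ?X x y)) \<le> ennreal (2 / real m ^ k)"
        using dist_box_le[of "fst p" k "i div H" "i mod H" "snd p"]
        by (auto simp: U_def split: if_splits intro!: ennreal_leI)
    qed
    have "mspace ?X \<subseteq> (\<Union>i. U i)"
    proof
      fix p assume "p \<in> mspace ?X"
      then have p: "p \<in> carpet m l D"
        by simp
      then obtain u j where uj: "u < N ^ k" "j < H" "p \<in> box k u j"
        using carpet_subset_boxes[OF k(1)] by (auto simp: H_def)
      have "u * H + j < Suc u * H"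
        using uj(2) by simp
      also have "\<dots> \<le> n"
        unfolding n_def using uj(1) by (intro mult_right_mono) auto
      finally have "p \<in> U (u * H + j)"
        using uj H p by (simp add: U_def)
      then show "p \<in> (\<Union>i. U i)"
        by blast
    qed
    moreover have "U i \<subseteq> mspace ?X \<and> ediam ?X (U i) \<le> ennreal \<delta>" for i
      using ediam[of i] k(2) by (auto simp: U_def intro: order_trans ennreal_leI)
    ultimately have "hausdorff_premeasure ?X s \<delta> \<le> (\<Sum>i. ennreal (enn2real (ediam ?X (U i)) powr s))"
      unfolding hausdorff_premeasure_def by (intro INF_lower) blast
    also have "\<dots> = (\<Sum>i<n. ennreal (enn2real (ediam ?X (U i)) powr s))"
      by (rule suminf_finite) (auto simp: U_def ediam_def bot_ennreal)
    also have "\<dots> \<le> (\<Sum>i<n. ennreal ((2 / real m ^ k) powr s))"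
    proof (rule sum_mono)
      fix i
      have "enn2real (ediam ?X (U i)) \<le> 2 / real m ^ k"
        using ediam[of i] by (intro enn2real_leI) auto
      then show "ennreal (enn2real (ediam ?X (U i)) powr s) \<le> ennreal ((2 / real m ^ k) powr s)"
        using s0 by (intro ennreal_leI powr_mono2) auto
    qed
    also have "\<dots> = ennreal (real n * (2 / real m ^ k) powr s)"
      by (simp add: ennreal_mult ennreal_of_nat_eq_real_of_nat)
    also have "\<dots> \<le> ennreal (2 powr s * real l * q ^ k)"
    proof (rule ennreal_leI)
      have "n \<le> N ^ k * (l * m ^ k)"
        unfolding n_def H_def using row_depth_pow_le by (intro mult_left_mono) auto
      then have "real n \<le> real (N ^ k * (l * m ^ k))"
        by (simp only: of_nat_le_iff)
      then have "real n * (2 / real m ^ k) powr s \<le> real (N ^ k * (l * m ^ k)) * (2 / real m ^ k) powr s"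
        by (intro mult_right_mono) auto
      also have "\<dots> = real (N ^ k * (l * m ^ k)) * (2 powr s / (real m powr s) ^ k)"
      proof -
        have "(real m ^ k) powr s = (real m powr s) ^ k"
          by (induction k) (simp_all add: powr_mult)
        then show ?thesis
          by (simp add: powr_divide)
      qed
      also have "\<dots> = 2 powr s * real l * q ^ k"
        by (simp add: q_def power_divide power_mult_distrib)
      finally show "real n * (2 / real m ^ k) powr s \<le> 2 powr s * real l * q ^ k" .
    qed
    finally show ?thesis .
  qed
  have "hausdorff_premeasure ?X s \<delta> \<le> 0" if \<delta>: "0 < \<delta>" for \<delta>
  proof -
    have lim: "(\<lambda>k. ennreal (2 powr s * real l * q ^ k)) \<longlonglongrightarrow> ennreal (2 powr s * real l * 0)"
      using q by (intro tendsto_ennrealI tendsto_mult tendsto_const LIMSEQ_realpow_zero)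
    have "(\<lambda>k. 2 * (1 / real m) ^ k) \<longlonglongrightarrow> 2 * 0"
      using m by (intro tendsto_mult tendsto_const LIMSEQ_realpow_zero) auto
    then have "\<forall>\<^sub>F k in sequentially. 2 * (1 / real m) ^ k < \<delta>"
      using \<delta> by (intro order_tendstoD(2)) auto
    then have "\<forall>\<^sub>F k in sequentially. hausdorff_premeasure ?X s \<delta> \<le> ennreal (2 powr s * real l * q ^ k)"
      using eventually_gt_at_top[of 0]
      by eventually_elim (intro bound, auto simp: power_one_over)
    then show ?thesis
      using tendsto_lowerbound[OF lim] by simp
  qed
  then show ?thesis
    unfolding hausdorff_measure_def by (intro antisym SUP_least) auto
qed

lemma hausdorff_dim_carpet_le:
  "hausdorff_dim (submetric euclidean_metric (carpet m l D)) \<le> ennreal carpet_dim"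
proof (rule ennreal_le_epsilon)
  fix e :: real
  assume e: "0 < e"
  have "hausdorff_dim (submetric euclidean_metric (carpet m l D)) \<le> ennreal (carpet_dim + e)"
    unfolding hausdorff_dim_def using hausdorff_measure_carpet_eq_0[of "carpet_dim + e"] e carpet_dim_ge_1
    by (intro INF_lower) auto
  then show "hausdorff_dim (submetric euclidean_metric (carpet m l D)) \<le> ennreal carpet_dim + ennreal e"
    using e carpet_dim_ge_1 by simp
qed

end

lemma quasisymmetric_id: "quasisymmetric X X id"
  unfolding quasisymmetric_def
  by (intro conjI exI[of _ id]) (auto simp: homeomorphic_map_id)

lemma uniform_carpet_exists:
  fixes m l :: nat and D :: "(nat \<times> nat) set"
  assumes "1 < l" and "l < m"
    and D: "D \<subseteq> {1..m} \<times> {1..l}" "D \<noteq> {}"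
    and rows: "\<forall>b \<in> {1..l}. \<forall>b' \<in> {1..l}. card (pattern_row D b) = card (pattern_row D b')"
  shows "\<exists>N col. uniform_carpet m l N D col"
proof -
  define N where "N = card (pattern_row D 1)"
  let ?R = "\<lambda>b. {a. (Suc a, Suc b) \<in> D}"
  have row: "pattern_row D (Suc b) = Suc ` ?R b" for b
  proof -
    have "\<exists>a'. a = Suc a'" if "(a, Suc b) \<in> D" for a
      using that D(1) by (intro not0_implies_Suc) auto
    then show ?thesis
      by (fastforce simp: pattern_row_def)
  qed
  have fin: "finite (?R b)" for b
    by (rule finite_subset[of _ "{..m}"]) (use D(1) in auto)
  have card: "card (?R b) = N" if "b < l" for b
  proof -
    have "N = card (pattern_row D (Suc b))"
      unfolding N_def using rows that assms(1) by auto
    then show ?thesis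
      by (simp add: row card_image)
  qed
  have "\<exists>h. b < l \<longrightarrow> bij_betw h {..<N} (?R b)" for b
    using ex_bij_betw_nat_finite[OF fin[of b]] card[of b] by (auto simp: lessThan_atLeast0)
  then obtain col where col: "\<And>b. b < l \<Longrightarrow> bij_betw (col b) {..<N} (?R b)"
    by metis
  have surj: "\<exists>c<N. \<exists>b'<l. b = Suc b' \<and> a = Suc (col b' c)" if ab: "(a, b) \<in> D" for a b
  proof -
    obtain a' b' where a'b': "a = Suc a'" "b = Suc b'" "b' < l"
      using ab D(1) by (cases a; cases b) auto
    then have "a' \<in> col b' ` {..<N}"
      using ab col[of b'] by (auto simp: bij_betw_def)
    then show ?thesis
      using a'b' by blast
  qed
  have "uniform_carpet m l N D col"
  proof
    show "0 < N"
      using D(2) surj by force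
    show mem: "(Suc (col b c), Suc b) \<in> D" if "b < l" "c < N" for b c
      using col[OF that(1)] that(2) by (auto simp: bij_betw_def)
    show "col b c < m" if "b < l" "c < N" for b c
      using mem[OF that] D(1) by auto
    show "inj_on (col b) {..<N}" if "b < l" for b
      using col[OF that] by (simp add: bij_betw_def)
  qed (use assms surj in auto)
  then show ?thesis
    by blast
qed

theorem corollary1p3:
  fixes m l :: nat and D :: "(nat \<times> nat) set"
  assumes "1 < l" and "l < m"
    and "D \<subseteq> {1..m} \<times> {1..l}" and "D \<noteq> {}"
    and "\<forall>b \<in> {1..l}. \<forall>b' \<in> {1..l}. card (pattern_row D b) = card (pattern_row D b')"
  shows "minimal_for_conformal_dim (submetric euclidean_metric (carpet m l D))"
proof -
  obtain N col where "uniform_carpet m l N D col"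
    using uniform_carpet_exists[OF assms] by blast
  then interpret uniform_carpet m l N D col .
  let ?X = "submetric euclidean_metric (carpet m l D)"
  have "hausdorff_dim ?X \<le> conformal_dim ?X"
    unfolding conformal_dim_def
    using hausdorff_dim_carpet_le hausdorff_dim_quasisymmetric_image_ge
    by (intro Inf_greatest) (auto intro: order_trans)
  moreover have "conformal_dim ?X \<le> hausdorff_dim ?X"
    by (rule conformal_dim_le[OF quasisymmetric_id])
  ultimately show ?thesis
    unfolding minimal_for_conformal_dim_def by (rule antisym[rotated])
qed

end
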